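(* Let $L$ be a planar triangulation with $n_L\ge 3$ vertices, embedded in the plane, and let $H$ be its planar conjugated triangulation. Then the bounded faces of $H$ split into two classes: (1) faces whose boundary consists of the three medians of one bounded face of $L$; each such face lies inside that face of $L$ and is a triangle; (2) faces containing a vertex of $L$ in their interior; each such face is a polygon with at least $3$ sides.
   Context: A planar triangulation is a maximal planar simple graph; fix a plane embedding of $L$, so all faces of $L$ are triangles. The planar conjugated triangulation $H$ of $L$ is the plane graph whose vertices are the midpoints of the edges of $L$, and in which, for every bounded face of $L$, the three midpoints of its three boundary edges are joined pairwise by three segments (medians) drawn inside that face; nothing is drawn inside the unbounded face of $L$. *)

theory Defs
  imports "HOL-Analysis.Analysis"
begin

text \<open>
  A simple graph together with a drawing of it in the plane.  Edges are two-element sets of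
  vertices; only the restriction of \<open>point\<close> to the vertices and of \<open>curve\<close> to the edges matters.
\<close>

record 'a drawing =
  vertices :: "'a set"
  edges :: "'a set set"
  point :: "'a \<Rightarrow> complex"
  curve :: "'a set \<Rightarrow> real \<Rightarrow> complex"

definition simple_graph :: "'a set \<Rightarrow> 'a set set \<Rightarrow> bool" where
  "simple_graph V E \<longleftrightarrow> finite V \<and> (\<forall>e\<in>E. e \<subseteq> V \<and> card e = 2)"

definition plane_graph :: "'a drawing \<Rightarrow> bool" where
  "plane_graph D \<longleftrightarrow>
     simple_graph (vertices D) (edges D) \<and>
     inj_on (point D) (vertices D) \<and>
     (\<forall>e\<in>edges D. arc (curve D e) \<and>
        {pathstart (curve D e), pathfinish (curve D e)} = point D ` e) \<and>
     (\<forall>e\<in>edges D. \<forall>v\<in>vertices D. point D v \<in> path_image (curve D e) \<longrightarrow> v \<in> e) \<and>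
     (\<forall>e\<in>edges D. \<forall>f\<in>edges D. e \<noteq> f \<longrightarrow>
        path_image (curve D e) \<inter> path_image (curve D f) \<subseteq> point D ` (e \<inter> f))"

definition planar :: "'a set \<Rightarrow> 'a set set \<Rightarrow> bool" where
  "planar V E \<longleftrightarrow> (\<exists>D. plane_graph D \<and> vertices D = V \<and> edges D = E)"

definition planar_triangulation :: "'a set \<Rightarrow> 'a set set \<Rightarrow> bool" where
  "planar_triangulation V E \<longleftrightarrow>
     planar V E \<and> (\<forall>E'. planar V E' \<and> E \<subseteq> E' \<longrightarrow> E' = E)"

definition bounded_faces :: "'a drawing \<Rightarrow> complex set set" where
  "bounded_faces D =
     {F \<in> components (- (point D ` vertices D \<union> (\<Union>e\<in>edges D. path_image (curve D e)))). bounded F}"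

definition boundary_edges :: "'a drawing \<Rightarrow> complex set \<Rightarrow> 'a set set" where
  "boundary_edges D F = {e \<in> edges D. path_image (curve D e) \<subseteq> frontier F}"

text \<open>
  The vertices of the conjugated triangulation are the edges of \<open>L\<close>, so a median, which joins the
  midpoints of two edges \<open>e\<close> and \<open>f\<close>, is the two-element set \<open>{e, f}\<close>.  Two edges of a planar
  triangulation lie together on the boundary of at most one bounded face, so that the pair
  determines the median.
\<close>

definition medians :: "'a drawing \<Rightarrow> complex set \<Rightarrow> 'a set set set" where
  "medians L T = {{e, f} | e f. e \<in> boundary_edges L T \<and> f \<in> boundary_edges L T \<and> e \<noteq> f}"

text \<open>
  The midpoint of an edge is the point of parameter \<open>1/2\<close> on its curve.  For a straight edge
  \<open>linepath a b\<close> this is \<open>midpoint a b\<close>; since a curve may be reparametrised, it is in general an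
  arbitrary point in the interior of the edge.  Likewise a median is an arc joining two midpoints
  inside a face, for instance a straight line segment if the face is a straight triangle.
\<close>

definition conjugated_triangulation :: "'a drawing \<Rightarrow> 'a set drawing \<Rightarrow> bool" where
  "conjugated_triangulation L H \<longleftrightarrow>
     plane_graph H \<and>
     vertices H = edges L \<and>
     (\<forall>e\<in>edges L. point H e = curve L e (1/2)) \<and>
     edges H = (\<Union>T\<in>bounded_faces L. medians L T) \<and>
     (\<forall>T\<in>bounded_faces L. \<forall>m\<in>medians L T. path_image (curve H m) - point H ` m \<subseteq> T)"

text \<open>
  \<open>F\<close> is the region enclosed by a cycle of length \<open>k\<close> of the plane graph \<open>D\<close>.  The sides are the
  edges of the drawing, so a triangle is the case \<open>k = 3\<close>.
\<close>

definition polygon_face :: "'a drawing \<Rightarrow> complex set \<Rightarrow> nat \<Rightarrow> bool" where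
  "polygon_face D F k \<longleftrightarrow>
     (\<exists>vs. length vs = k \<and> distinct vs \<and>
        (\<forall>i<k. {vs ! i, vs ! (Suc i mod k)} \<in> edges D) \<and>
        frontier F = (\<Union>i<k. path_image (curve D {vs ! i, vs ! (Suc i mod k)})) \<and>
        F = inside (frontier F))"

definition bounded_by_medians :: "'a drawing \<Rightarrow> 'a set drawing \<Rightarrow> complex set \<Rightarrow> complex set \<Rightarrow> bool"
  where "bounded_by_medians L H T F \<longleftrightarrow> frontier F = (\<Union>m\<in>medians L T. path_image (curve H m))"

end

(*
  A maximal planar graph has only triangular faces: two vertices on the frontier of a face are
  accessible from it, so they are adjacent (otherwise the edge could be added inside the face), and
  four pairwise adjacent vertices never lie on a common face frontier.  The topological input is
  Janiszewski's theorem.  It gives that the frontier of a face contains every edge it meets in an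
  interior point, and that near an interior point of one arc of a theta curve there are only the two
  sides belonging to the other two arcs; hence no face of a theta curve touches all three open arcs.

  The medians of a bounded face T form a Jordan curve whose inside lies in T, and a face of H that
  avoids the vertices of L must be such an inside.  If a bounded face F of H contains a vertex v of L,
  every edge at v lies on exactly two faces of L, so the medians cutting off corners at v contain a
  cycle.  The corners cut off by this cycle, together with the half edges between them, are open and
  relatively closed in F - {v}, so they fill it, and F is the inside of the cycle.
*)

theory Submission
  imports Defs
begin

section \<open>Arcs and Jordan curves\<close>

text \<open>Edges are arbitrary arcs, and maximality only says that no edge can be added, so neither
  triangular faces nor a cyclic order of the edges at a vertex is available at the start. Two
  obstacles shape the proof. First, a frontier point of an open set need not be reachable by a path
  from inside, so drawing a new edge in a face needs an argument at its ends: finitely many arcs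
  meet there, and every piece of the complement close to the centre has the centre in its closure.
  Secondly, no rotation system is built. The edges at v are only a finite graph in which each has at
  least two neighbours; any cycle in it is taken, and connectedness of F without the point v shows
  afterwards that the corners along it leave no room for anything else. Boundedness of F enters in
  between: an unbounded face of L contains no part of H, so with v on its frontier it would be
  absorbed by F; hence all faces at v carry medians.\<close>

definition is_arc :: "complex set \<Rightarrow> complex \<Rightarrow> complex \<Rightarrow> bool" where
  "is_arc A a b \<longleftrightarrow> (\<exists>g. arc g \<and> pathstart g = a \<and> pathfinish g = b \<and> path_image g = A)"

definition jordan_curve :: "complex set \<Rightarrow> bool" where
  "jordan_curve C \<longleftrightarrow> (\<exists>c. simple_path c \<and> pathfinish c = pathstart c \<and> path_image c = C)"

lemma is_arcE:
  assumes "is_arc A a b"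
  obtains g where "arc g" "pathstart g = a" "pathfinish g = b" "path_image g = A"
  using assms unfolding is_arc_def by blast

lemma is_arc_sym: "is_arc A a b \<Longrightarrow> is_arc A b a"
  unfolding is_arc_def
  by (metis arc_reversepath path_image_reversepath pathfinish_reversepath pathstart_reversepath)

lemma is_arc_compact: "is_arc A a b \<Longrightarrow> compact A"
  unfolding is_arc_def using compact_arc_image by blast

lemma is_arc_closed: "is_arc A a b \<Longrightarrow> closed A"
  using is_arc_compact compact_imp_closed by blast

lemma is_arc_connected: "is_arc A a b \<Longrightarrow> connected A"
  unfolding is_arc_def using connected_arc_image by blast

lemma is_arc_complement: "is_arc A a b \<Longrightarrow> connected (- A)"
  unfolding is_arc_def using connected_arc_complement[where 'a = complex] by auto

lemma is_arc_ends: "is_arc A a b \<Longrightarrow> a \<in> A \<and> b \<in> A \<and> a \<noteq> b"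
  unfolding is_arc_def by (metis arc_distinct_ends pathfinish_in_path_image pathstart_in_path_image)

lemma is_arc_join:
  assumes "is_arc A a b" "is_arc B b c" "A \<inter> B \<subseteq> {b}"
  shows "is_arc (A \<union> B) a c"
proof -
  obtain g h where "arc g" "pathstart g = a" "pathfinish g = b" "path_image g = A"
    "arc h" "pathstart h = b" "pathfinish h = c" "path_image h = B"
    using assms by (meson is_arcE)
  then have "arc (g +++ h) \<and> pathstart (g +++ h) = a \<and> pathfinish (g +++ h) = c \<and>
      path_image (g +++ h) = A \<union> B"
    using assms(3) by (auto simp: arc_join path_image_join)
  then show ?thesis
    unfolding is_arc_def by blast
qed

lemma is_arc_subpath:
  assumes "arc g" "0 \<le> s" "s < t" "t \<le> 1"
  shows "is_arc (g ` {s..t}) (g s) (g t)"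
  unfolding is_arc_def
  using assms by (intro exI[of _ "subpath s t g"]) (auto simp: arc_subpath_arc path_image_subpath)

lemma is_arc_open_image:
  assumes "arc g" "pathstart g = a" "pathfinish g = b" "path_image g = A"
  shows "A - {a, b} = g ` {0<..<1}"
proof -
  have inj: "inj_on g {0..1}" using assms by (simp add: arc_def)
  have "A - {a, b} = g ` {0..1} - g ` {0, 1}"
    using assms by (auto simp: path_image_def pathstart_def pathfinish_def)
  also have "\<dots> = g ` ({0..1} - {0, 1})"
    by (rule inj_on_image_set_diff[OF inj, symmetric]) auto
  also have "{0..1} - {0, 1} = {0<..<1::real}" by auto
  finally show ?thesis .
qed

lemma arc_continuous: "arc g \<Longrightarrow> continuous_on {0..1} g"
  by (simp add: arc_def path_def)

lemma is_arc_open_connected: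
  assumes "is_arc A a b"
  shows "connected (A - {a, b})" "A - {a, b} \<noteq> {}" "A \<subseteq> closure (A - {a, b})"
proof -
  obtain g where g: "arc g" "pathstart g = a" "pathfinish g = b" "path_image g = A"
    using assms by (meson is_arcE)
  note eq = is_arc_open_image[OF g]
  show "connected (A - {a, b})"
    unfolding eq
    by (rule connected_continuous_image)
      (use arc_continuous[OF g(1)] in \<open>auto intro: continuous_on_subset\<close>)
  show "A - {a, b} \<noteq> {}" unfolding eq by simp
  have "g ` closure {0<..<1} \<subseteq> closure (g ` {0<..<1})"
    by (rule image_closure_subset) (use arc_continuous[OF g(1)] in \<open>auto intro: subsetD[OF closure_subset]\<close>)
  then show "A \<subseteq> closure (A - {a, b})"
    unfolding eq using g(4) by (simp add: path_image_def)
qed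

lemma is_arc_infinite: "is_arc A a b \<Longrightarrow> infinite A"
  by (metis connected_finite_iff_sing is_arc_connected is_arc_ends empty_iff insert_iff)

text \<open>Half-open arcs are the connected sets that touch a drawing only at the deleted end;
  maximality of components then puts them as a whole into one face.\<close>

lemma is_arc_delete_end:
  assumes "is_arc A a b"
  shows "connected (A - {a})"
proof -
  have "A - {a, b} \<subseteq> A - {a}" "A - {a} \<subseteq> closure (A - {a, b})"
    using is_arc_open_connected[OF assms] by auto
  then show ?thesis
    using connected_intermediate_closure is_arc_open_connected(1)[OF assms] by blast
qed

text \<open>A parametrisation has a continuous injective inverse on the arc, and invariance of
  dimension forbids embedding an open piece of the plane in the line. This supplies points off an
  arc arbitrarily close to it.\<close>

lemma is_arc_interior:
  assumes "is_arc A a b"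
  shows "interior A = {}"
proof (rule ccontr)
  assume ne: "interior A \<noteq> {}"
  obtain g where g: "arc g" "path_image g = A"
    using assms by (meson is_arcE)
  obtain h where "homeomorphism {0..1} A g h"
    using homeomorphism_arc[OF g(1)] g(2) by blast
  then have "continuous_on A h" "inj_on h A"
    by (auto simp: homeomorphism_def intro: inj_on_inverseI)
  then have "DIM(complex) \<le> DIM(real)"
    using invariance_of_dimension[of "interior A" h] ne interior_subset[of A]
    by (meson continuous_on_subset inj_on_subset open_interior)
  then show False by simp
qed

lemma jordan_curveI:
  assumes "is_arc A a b" "is_arc B a b" "A \<inter> B \<subseteq> {a, b}"
  shows "jordan_curve (A \<union> B)"
proof -
  obtain g h where "arc g" "pathstart g = a" "pathfinish g = b" "path_image g = A"
    "arc h" "pathstart h = b" "pathfinish h = a" "path_image h = B"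
    using assms is_arc_sym by (meson is_arcE)
  then have "simple_path (g +++ h) \<and> pathfinish (g +++ h) = pathstart (g +++ h) \<and>
      path_image (g +++ h) = A \<union> B"
    using assms(3) by (auto simp: simple_path_join_loop path_image_join)
  then show ?thesis
    unfolding jordan_curve_def by blast
qed

section \<open>Components of complements and the two sides of a Jordan curve\<close>

lemma component_facts:
  fixes K :: "complex set"
  assumes "closed K" "F \<in> components (- K)"
  shows "open F" "connected F" "F \<noteq> {}" "F \<inter> K = {}" "frontier F \<subseteq> K" "closure F \<subseteq> F \<union> K"
proof -
  show "open F" using assms open_components by (metis open_Compl)
  show "connected F" using assms in_components_connected by blast
  show "F \<noteq> {}" using assms in_components_nonempty by blast
  show "F \<inter> K = {}" using assms in_components_subset by blast
  show fr: "frontier F \<subseteq> K" using assms frontier_of_components_closed_complement by blast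
  then show "closure F \<subseteq> F \<union> K" by (metis closure_Un_frontier Un_mono order_refl)
qed

text \<open>A larger connected set would cross the frontier of \<open>F\<close>, which lies in
  \<open>K\<close>. This is the device for shrinking an obstacle: a face of a large drawing remains
  a component when only a part containing its frontier is kept.\<close>

lemma component_if_frontier_subset:
  fixes K :: "complex set"
  assumes "connected F" "F \<noteq> {}" "F \<inter> K = {}" "frontier F \<subseteq> K"
  shows "F \<in> components (- K)"
  unfolding in_components_maximal
proof (intro conjI allI impI)
  fix D assume D: "D \<noteq> {} \<and> F \<subseteq> D \<and> D \<subseteq> - K \<and> connected D"
  show "D = F"
  proof (rule ccontr)
    assume "D \<noteq> F"
    then have "D - F \<noteq> {}" "D \<inter> F \<noteq> {}" using D assms(2) by auto
    then have "D \<inter> frontier F \<noteq> {}" using D connected_Int_frontier by blast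
    then show False using D assms(4) by auto
  qed
qed (use assms in auto)

lemma jordan_curve_components:
  assumes "jordan_curve C"
  shows "components (- C) = {inside C, outside C}" "inside C \<noteq> outside C"
    "frontier (inside C) = C" "frontier (outside C) = C" "bounded (inside C)"
    "\<not> bounded (outside C)" "compact C"
proof -
  obtain c where c: "simple_path c" "pathfinish c = pathstart c" "path_image c = C"
    using assms unfolding jordan_curve_def by blast
  note J = Jordan_inside_outside[OF c(1,2), unfolded c(3)]
  show fr: "frontier (inside C) = C" "frontier (outside C) = C" "bounded (inside C)"
    "\<not> bounded (outside C)" using J by auto
  then show "inside C \<noteq> outside C" by metis
  show "compact C" using c compact_simple_path_image by blast
  have "inside C \<in> components (- C)" "outside C \<in> components (- C)"
    using J by (intro component_if_frontier_subset; blast)+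
  moreover have "X \<in> {inside C, outside C}" if "X \<in> components (- C)" for X
  proof -
    have "X \<subseteq> inside C \<union> outside C" "X \<noteq> {}"
      using that J in_components_subset in_components_nonempty by blast+
    then show ?thesis
      using components_eq[OF that] calculation by blast
  qed
  ultimately show "components (- C) = {inside C, outside C}" by blast
qed

lemma jordan_component_facts:
  assumes "jordan_curve C" "F \<in> components (- C)"
  shows "frontier F = C" "open F" "connected F" "F \<noteq> {}" "F \<inter> C = {}" "closure F = F \<union> C"
proof -
  note J = jordan_curve_components[OF assms(1)]
  show 1: "frontier F = C" using J assms(2) by auto
  have "closed C" using J compact_imp_closed by blast
  then show "open F" "connected F" "F \<noteq> {}" "F \<inter> C = {}"
    using component_facts[OF _ assms(2)] by blast+
  show "closure F = F \<union> C" using 1 by (metis closure_Un_frontier)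
qed

lemma jordan_other_component:
  assumes "jordan_curve C" "D \<inter> C = {}" "connected D" "D \<noteq> {}"
  obtains F G where "F \<in> components (- C)" "G \<in> components (- C)" "F \<noteq> G"
    "F \<union> G = - C" "D \<subseteq> G" "D \<inter> F = {}"
proof -
  note J = jordan_curve_components[OF assms(1)]
  have u: "inside C \<union> outside C = - C" using J(1) Union_components[of "- C"] by simp
  obtain G where G: "G \<in> components (- C)" "D \<subseteq> G"
    using exists_component_superset[of D "- C"] assms by blast
  define F where "F = (if G = inside C then outside C else inside C)"
  have "G = inside C \<or> G = outside C" using G(1) J(1) by blast
  then have "F \<in> components (- C)" "F \<noteq> G" "F \<union> G = - C"
    using J(1,2) u unfolding F_def by (smt (verit) insertCI Un_commute)+
  moreover from this have "D \<inter> F = {}" using components_eq[of F "- C" G] G by blast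
  ultimately show thesis using that G by blast
qed

text \<open>
  If \<open>g t\<close> were not on the frontier, a piece of the arc just beyond it could be deleted without
  changing \<open>F\<close>.  By Janiszewski's theorem the dangling arc that remains does not separate the
  plane near \<open>g t\<close> from \<open>F\<close>.
\<close>

lemma arc_in_frontier_aux:
  fixes g :: "real \<Rightarrow> complex"
  assumes "closed K0" "arc g" "K0 \<inter> path_image g \<subseteq> {g 0, g 1}"
    and F: "F \<in> components (- (K0 \<union> path_image g))"
    and "0 < s" "s < t" "t < 1" "g s \<in> frontier F"
  shows "g t \<in> frontier F"
proof (rule ccontr)
  assume nt: "g t \<notin> frontier F"
  have clK: "closed (K0 \<union> path_image g)"
    using assms closed_arc_image by blast
  note FF = component_facts[OF clK F]
  have inj: "inj_on g {0..1}" and cont: "continuous_on {0..1} g"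
    using assms arc_continuous by (auto simp: arc_def)
  have "g t \<in> path_image g" using assms by (auto simp: path_image_def)
  then have ncl: "g t \<notin> closure F" using nt FF
    by (metis IntI UnI2 closure_Un_frontier Un_iff empty_iff)
  obtain e where e: "e > 0" "ball (g t) e \<inter> closure F = {}"
    by (metis ncl closed_closure open_Compl open_contains_ball Compl_iff disjoint_eq_subset_Compl)
  obtain d where d: "d > 0" "\<And>u. u \<in> {0..1} \<Longrightarrow> dist u t < d \<Longrightarrow> dist (g u) (g t) < e"
    using cont[unfolded continuous_on_iff, rule_format, of t e] assms e(1) by auto
  \<comment> \<open>\<open>(t + 1) / 2\<close> keeps \<open>t'\<close> below 1, and
    \<open>t + d / 2\<close> keeps the piece of the arc from \<open>t\<close> to \<open>t'\<close>
    in the ball that avoids \<open>closure F\<close>. This is the piece to be deleted.\<close>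
  define t' where "t' = min ((t + 1) / 2) (t + d / 2)"
  have t': "t < t'" "t' < 1" using assms d by (auto simp: t'_def min_def)
  have mid: "g u \<notin> closure F" if "t \<le> u" "u \<le> t'" for u
  proof -
    have "dist u t < d" using that d(1) by (auto simp: t'_def dist_real_def)
    then have "g u \<in> ball (g t) e" using d(2)[of u] that t' assms by (auto simp: dist_commute)
    then show ?thesis using e by blast
  qed
  \<comment> \<open>\<open>D\<close> ends at \<open>g t\<close>, and \<open>K2\<close> takes up the
    arc again at \<open>t'\<close>. The two meet at most in \<open>g 0\<close>, which gives the
    connected intersection that Janiszewski's theorem asks for.\<close>
  define D where "D = g ` {0..t}"
  define K2 where "K2 = K0 \<union> g ` {t'..1}"
  have arcD: "is_arc D (g 0) (g t)"
    unfolding D_def using assms by (intro is_arc_subpath) auto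
  have arcE: "is_arc (g ` {t'..1}) (g t') (g 1)"
    using assms t' by (intro is_arc_subpath) auto
  have clK2: "closed K2" unfolding K2_def using assms is_arc_closed[OF arcE] by blast
  have "D \<inter> g ` {t'..1} = g ` ({0..t} \<inter> {t'..1})"
    unfolding D_def by (rule inj_on_image_Int[OF inj, symmetric]) (use t' assms in auto)
  also have "\<dots> = {}" using t' by auto
  finally have D2: "D \<inter> g ` {t'..1} = {}" .
  have Dsub: "D \<subseteq> path_image g" unfolding D_def path_image_def using assms by auto
  have g1: "g 1 \<notin> D"
    unfolding D_def using inj_onD[OF inj, of 1] assms by fastforce
  have DK2: "D \<inter> K2 \<subseteq> {g 0}" using D2 Dsub g1 assms(3) unfolding K2_def by blast
  have conn: "connected (D \<inter> K2)" using DK2 by (metis connected_empty connected_sing subset_singletonD)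
  have sub: "D \<union> K2 \<subseteq> K0 \<union> path_image g"
    using Dsub t' assms unfolding K2_def path_image_def by auto
  have fr: "frontier F \<subseteq> D \<union> K2"
  proof
    fix z assume z: "z \<in> frontier F"
    then consider "z \<in> K0" | u where "u \<in> {0..1}" "z = g u"
      using FF(5) unfolding path_image_def by blast
    then show "z \<in> D \<union> K2"
    proof cases
      case 1 then show ?thesis by (simp add: K2_def)
    next
      case (2 u)
      have "z \<in> closure F" using z by (simp add: frontier_def)
      then have "\<not> (t \<le> u \<and> u \<le> t')" using mid 2 by blast
      then show ?thesis using 2 unfolding D_def K2_def by auto
    qed
  qed
  have "F \<inter> (D \<union> K2) = {}" using FF(4) sub by blast
  then have F': "F \<in> components (- (D \<union> K2))"
    using component_if_frontier_subset FF(2,3) fr by blast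
  have gsD: "g s \<in> D - {g 0}" "g t \<in> D - {g 0}"
    using assms inj_onD[OF inj, of s 0] inj_onD[OF inj, of t 0] unfolding D_def by auto
  have cF: "connected (insert (g s) F)"
  proof (rule connected_intermediate_closure[OF FF(2)])
    show "insert (g s) F \<subseteq> closure F"
      using assms(8) closure_subset[of F] by (simp add: frontier_def)
  qed blast
  have gt2: "g t \<notin> K2" using gsD DK2 by blast
  obtain r where r: "r > 0" "ball (g t) r \<inter> (K2 \<union> closure F) = {}"
  proof -
    have "open (- (K2 \<union> closure F))" "g t \<in> - (K2 \<union> closure F)"
      using clK2 gt2 ncl by auto
    then show thesis using that by (metis open_contains_ball disjoint_eq_subset_Compl)
  qed
  have "\<not> ball (g t) r \<subseteq> D"
    using is_arc_interior[OF arcD] r(1)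
    by (metis centre_in_ball empty_iff interior_maximal open_ball subset_eq)
  then obtain q where q: "q \<in> ball (g t) r" "q \<notin> D" by blast
  obtain p where p: "p \<in> F" using FF by blast
  \<comment> \<open>From \<open>F\<close> through its frontier point \<open>g s\<close> and along
    \<open>D\<close> to the disc at \<open>g t\<close>, all of it off \<open>K2\<close>. The other
    hypothesis of Janiszewski's theorem is free, since the arc \<open>D\<close> alone separates
    nothing.\<close>
  define Y where "Y = insert (g s) F \<union> (D - {g 0}) \<union> ball (g t) r"
  have "connected Y"
    unfolding Y_def using cF is_arc_delete_end[OF arcD] gsD r(1)
    by (intro connected_Un) auto
  moreover have "Y \<subseteq> - K2"
  proof -
    have "insert (g s) F \<inter> K2 = {}" "(D - {g 0}) \<inter> K2 = {}" "ball (g t) r \<inter> K2 = {}"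
      using FF(4) sub DK2 gsD r(2) by blast+
    then show ?thesis unfolding Y_def by blast
  qed
  moreover have "p \<in> Y" "q \<in> Y" using p q by (auto simp: Y_def)
  ultimately have 1: "connected_component (- K2) p q"
    by (meson connected_component_def)
  have "p \<in> - D" using p FF(4) sub by blast
  then have 2: "connected_component (- D) p q"
    using is_arc_complement[OF arcD] q by (meson ComplI connected_component_def subset_refl)
  have "connected_component (- (D \<union> K2)) p q"
    by (rule Janiszewski[OF is_arc_compact[OF arcD] clK2 conn 2 1])
  then obtain Z where "connected Z" "Z \<subseteq> - (D \<union> K2)" "p \<in> Z" "q \<in> Z"
    by (auto simp: connected_component_def)
  then have "q \<in> F"
    using components_maximal[OF F', of Z] p by blast
  then show False using q r(2) closure_subset by blast
qed

lemma arc_in_frontier: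
  assumes K0: "closed K0" "is_arc A a b" "K0 \<inter> A \<subseteq> {a, b}"
    and F: "F \<in> components (- (K0 \<union> A))" and x: "x \<in> frontier F" "x \<in> A - {a, b}"
  shows "A \<subseteq> frontier F"
proof -
  obtain g where g: "arc g" "pathstart g = a" "pathfinish g = b" "path_image g = A"
    using assms(2) by (meson is_arcE)
  have g01: "g 0 = a" "g 1 = b" using g by (auto simp: pathstart_def pathfinish_def)
  note eq = is_arc_open_image[OF g]
  obtain s where s: "0 < s" "s < 1" "x = g s" using x(2) unfolding eq by auto
  have "g t \<in> frontier F" if t: "0 < t" "t < 1" for t
  proof (cases t s rule: linorder_cases)
    case equal then show ?thesis using x s by simp
  next
    case greater
    then show ?thesis
      using arc_in_frontier_aux[of K0 g F s t] assms g s t g01 by auto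
  next
    case less
    \<comment> \<open>The auxiliary lemma only moves towards larger parameters; smaller ones are
      reached on the reversed arc.\<close>
    have "reversepath g (1 - t) \<in> frontier F"
      by (rule arc_in_frontier_aux[of K0 _ F "1 - s"])
        (use assms g g01 s t less in \<open>simp_all add: arc_reversepath path_image_reversepath, simp_all add: reversepath_def insert_commute\<close>)
    then show ?thesis by (simp add: reversepath_def)
  qed
  then have "A - {a, b} \<subseteq> frontier F" unfolding eq by auto
  then have "closure (A - {a, b}) \<subseteq> frontier F" by (simp add: closure_minimal)
  then show ?thesis using is_arc_open_connected(3)[OF assms(2)] by blast
qed

section \<open>Accessible points and theta curves\<close>

text \<open>The n-th path is run through on the interval from n to n + 1, and t / (1 - t) squeezes
  the half line into the parameters below 1. The shrinking balls give continuity at the added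
  endpoint.\<close>

lemma infinite_join:
  fixes \<gamma> :: "nat \<Rightarrow> real \<Rightarrow> complex"
  assumes path: "\<And>n. path (\<gamma> n)"
    and join: "\<And>n. pathfinish (\<gamma> n) = pathstart (\<gamma> (Suc n))"
    and lim: "\<And>n. path_image (\<gamma> n) \<subseteq> ball v (1 / Suc n)"
  obtains g where "path g" "pathstart g = pathstart (\<gamma> 0)" "pathfinish g = v"
    "path_image g \<subseteq> insert v (\<Union>n. path_image (\<gamma> n))"
proof -
  define h where "h t = \<gamma> (nat \<lfloor>t\<rfloor>) (frac t)" for t :: real
  have h_eq: "h t = \<gamma> n (t - real n)" if "t \<in> {real n..real (Suc n)}" for t n
  proof (cases "t = real (Suc n)")
    case True
    have "\<lfloor>t\<rfloor> = int (Suc n)" using True by (metis floor_of_nat)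
    then have nt: "nat \<lfloor>t\<rfloor> = Suc n" and "frac t = 0"
      using True unfolding frac_def by (metis nat_int, simp)
    then have "h t = \<gamma> (Suc n) 0" by (simp only: h_def nt)
    then show ?thesis
      using join[of n] True by (simp add: pathstart_def pathfinish_def)
  next
    case False
    then have "\<lfloor>t\<rfloor> = int n" using that by (intro floor_unique) auto
    then show ?thesis by (simp add: h_def frac_def)
  qed
  have contn: "continuous_on {0..real n} h" for n
  proof (induction n)
    case 0 then show ?case by simp
  next
    case (Suc n)
    have "continuous_on {real n..real (Suc n)} (\<lambda>t. \<gamma> n (t - real n))"
    proof (rule continuous_on_compose2[of "{0..1}" "\<gamma> n"])
      show "continuous_on {0..1} (\<gamma> n)" using path[of n] by (simp add: path_def)
    qed (auto intro!: continuous_intros)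
    then have "continuous_on {real n..real (Suc n)} h"
      using h_eq by (subst continuous_on_cong[OF refl]) auto
    then have "continuous_on ({0..real n} \<union> {real n..real (Suc n)}) h"
      using Suc by (intro continuous_on_closed_Un) auto
    moreover have "{0..real n} \<union> {real n..real (Suc n)} = {0..real (Suc n)}" by auto
    ultimately show ?case by simp
  qed
  have h_img: "h t \<in> path_image (\<gamma> (nat \<lfloor>t\<rfloor>))" if "0 \<le> t" for t
    unfolding h_def path_image_def
    by (rule imageI) (use frac_lt_1[of t] frac_ge_0[of t] in \<open>auto intro: less_imp_le\<close>)
  define g where "g t = (if t = 1 then v else h (t / (1 - t)))" for t :: real
  have g_h: "continuous_on {0..s} g" if s: "s < 1" for s
  proof -
    obtain n where n: "s / (1 - s) \<le> real n" using real_arch_simple by blast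
    have mono: "t / (1 - t) \<le> s / (1 - s)" if "t \<le> s" for t
      using that s by (auto simp: field_simps)
    have "continuous_on {0..s} (\<lambda>t. h (t / (1 - t)))"
    proof (rule continuous_on_compose2[OF contn[of n]])
      show "continuous_on {0..s} (\<lambda>t. t / (1 - t))"
        using s by (intro continuous_intros) auto
      show "(\<lambda>t. t / (1 - t)) ` {0..s} \<subseteq> {0..real n}"
        using mono n s by (fastforce intro: order_trans)
    qed
    then show ?thesis
      by (rule continuous_on_eq) (use s in \<open>auto simp: g_def\<close>)
  qed
  have "continuous_on {0..1} g"
    unfolding continuous_on_eq_continuous_within
  proof
    fix t :: real assume t: "t \<in> {0..1}"
    show "continuous (at t within {0..1}) g"
    proof (cases "t = 1")
      case False
      define s where "s = (t + 1) / 2"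
      have s: "t < s" "s < 1" using t False by (auto simp: s_def)
      have "continuous (at t within {0..s}) g"
        using g_h[OF s(2)] t s by (simp add: continuous_on_eq_continuous_within)
      moreover have "at t within {0..s} = at t within {0..1}"
        by (rule at_within_nhd[of t "{..<s}"]) (use s in auto)
      ultimately show ?thesis by simp
    next
      case True
      show ?thesis
        unfolding continuous_within_eps_delta
      proof (intro allI impI)
        fix e :: real assume e: "e > 0"
        obtain n where n: "n > 0" "1 / real n < e" using ex_inverse_of_nat_less[OF e] by (auto simp: inverse_eq_divide)
        show "\<exists>d>0. \<forall>x'\<in>{0..1}. dist x' t < d \<longrightarrow> dist (g x') (g t) < e"
        \<comment> \<open>\<open>1 / (1 + real n)\<close> is the value of \<open>1 - x\<close> for
          which \<open>x / (1 - x)\<close> equals \<open>n\<close>; closer to 1 only paths with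
          index at least \<open>n\<close> are met.\<close>
        proof (intro exI[of _ "1 / (1 + real n)"] conjI ballI impI)
          fix x assume x: "x \<in> {0..1}" "dist x t < 1 / (1 + real n)"
          show "dist (g x) (g t) < e"
          proof (cases "x = 1")
            case False
            then have x1: "0 \<le> x" "x < 1" using x by auto
            have "1 - x < 1 / (1 + real n)" using x True x1 by (simp add: dist_real_def)
            then have "(1 - x) * (1 + real n) < 1" by (simp add: field_simps)
            then have "real n * (1 - x) \<le> x" by (simp add: algebra_simps)
            then have ge: "real n \<le> x / (1 - x)" using x1 by (simp add: field_simps)
            let ?m = "nat \<lfloor>x / (1 - x)\<rfloor>"
            have m: "n \<le> ?m" using ge by (simp add: le_nat_floor)
            have "h (x / (1 - x)) \<in> ball v (1 / Suc ?m)"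
              using h_img[of "x / (1 - x)"] lim x1 by fastforce
            moreover have "1 / Suc ?m \<le> 1 / real n" using m n by (simp add: field_simps)
            ultimately show ?thesis
              using n x1 True by (auto simp: g_def dist_commute)
          qed (use True e in \<open>simp add: g_def\<close>)
        qed auto
      qed
    qed
  qed
  then have "path g" by (simp add: path_def)
  moreover have "pathstart g = pathstart (\<gamma> 0)"
    by (simp add: pathstart_def g_def h_def)
  moreover have "pathfinish g = v" by (simp add: pathfinish_def g_def)
  moreover have "path_image g \<subseteq> insert v (\<Union>n. path_image (\<gamma> n))"
  proof -
    have "g t \<in> insert v (\<Union>n. path_image (\<gamma> n))" if "t \<in> {0..1}" for t
      using h_img[of "t / (1 - t)"] that by (auto simp: g_def)
    then show ?thesis unfolding path_image_def by blast
  qed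
  ultimately show thesis by (rule that)
qed

text \<open>The local hypothesis lets a point of \<open>F\<close> near \<open>v\<close> be moved
  arbitrarily close to \<open>v\<close> without leaving a prescribed small ball. Dependent choice
  turns this into a sequence whose joining paths shrink to \<open>v\<close>.\<close>

lemma accessible_if_locally:
  fixes U :: "complex set"
  assumes "open U" "F \<in> components U" "v \<in> closure F" "p \<in> F"
    and loc: "\<And>\<delta>. \<delta> > 0 \<Longrightarrow> \<exists>\<delta>'>0. \<forall>q\<in>ball v \<delta>' \<inter> U.
        v \<in> closure (connected_component_set (ball v \<delta> \<inter> U) q)"
  obtains g where "path g" "pathstart g = p" "pathfinish g = v" "path_image g \<subseteq> insert v F"
proof -
  have "\<forall>n. \<exists>d>0. \<forall>q\<in>ball v d \<inter> U.
      v \<in> closure (connected_component_set (ball v (1 / Suc n) \<inter> U) q)"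
    using loc by simp
  then obtain d where d: "\<And>n. d n > 0"
      "\<And>n q. q \<in> ball v (d n) \<inter> U \<Longrightarrow> v \<in> closure (connected_component_set (ball v (1 / Suc n) \<inter> U) q)"
    by metis
  \<comment> \<open>One radius for two demands: below \<open>d n\<close> the local hypothesis
    applies, and below \<open>1 / Suc n\<close> the point lies in the ball in which its component is
    taken.\<close>
  define r where "r n = min (d n) (1 / Suc n)" for n
  have r: "r n > 0" for n using d by (simp add: r_def)
  define C where "C n = connected_component_set (ball v (1 / Suc n) \<inter> U)" for n
  define Q where "Q n q \<longleftrightarrow> q \<in> F \<inter> ball v (r n)" for n q
  have FU: "F \<subseteq> U" using assms in_components_subset by blast
  have Fconn: "connected F" using assms in_components_connected by blast
  have openF: "open F" using assms open_components by blast
  have CF: "C n q \<subseteq> F" if "Q n q" for n q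
  proof -
    have "q \<in> F" "q \<in> ball v (1 / Suc n) \<inter> U" using that FU by (auto simp: Q_def r_def)
    then have "q \<in> C n q" "C n q \<subseteq> U" "connected (C n q)"
      using connected_component_subset[of "ball v (1 / Suc n) \<inter> U" q] by (auto simp: C_def)
    then show ?thesis using components_maximal[OF assms(2)] \<open>q \<in> F\<close> by blast
  qed
  have step: "\<exists>q'. Q (Suc n) q' \<and> q' \<in> C n q" if "Q n q" for n q
  proof -
    have "v \<in> closure (C n q)"
      unfolding C_def using that FU by (intro d(2)) (auto simp: Q_def r_def)
    then obtain q' where "q' \<in> C n q" "dist q' v < r (Suc n)"
      using r closure_approachable by metis
    then show ?thesis using CF[OF that] by (auto simp: Q_def dist_commute)
  qed
  have "\<exists>q. Q 0 q" using assms(3) r[of 0] by (auto simp: closure_approachable Q_def dist_commute)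
  then obtain q where q: "\<And>n. Q n (q n)" "\<And>n. q (Suc n) \<in> C n (q n)"
    using dependent_nat_choice[of Q "\<lambda>n x y. y \<in> C n x"] step by blast
  have "\<exists>\<gamma>. path \<gamma> \<and> path_image \<gamma> \<subseteq> C n (q n) \<and> pathstart \<gamma> = q n \<and> pathfinish \<gamma> = q (Suc n)" for n
  proof -
    have "q n \<in> ball v (1 / Suc n) \<inter> U" using q(1)[of n] FU by (auto simp: Q_def r_def)
    then have "q n \<in> C n (q n)" by (simp add: C_def)
    moreover have "open (C n (q n))"
      unfolding C_def using assms(1) by (intro open_connected_component open_Int open_ball)
    then have "path_connected (C n (q n))"
      by (simp add: C_def connected_open_path_connected)
    ultimately show ?thesis using q(2)[of n] unfolding path_connected_def by blast
  qed
  then obtain \<gamma> where \<gamma>: "\<And>n. path (\<gamma> n)" "\<And>n. path_image (\<gamma> n) \<subseteq> C n (q n)"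
    "\<And>n. pathstart (\<gamma> n) = q n" "\<And>n. pathfinish (\<gamma> n) = q (Suc n)" by metis
  have "C n (q n) \<subseteq> ball v (1 / Suc n)" for n
    unfolding C_def using connected_component_subset by blast
  then obtain g where g: "path g" "pathstart g = q 0" "pathfinish g = v"
    "path_image g \<subseteq> insert v (\<Union>n. path_image (\<gamma> n))"
    using infinite_join[of \<gamma> v] \<gamma> by (metis order_trans)
  have gF: "path_image g \<subseteq> insert v F" using g(4) \<gamma>(2) CF q(1) by blast
  have "path_connected F" using Fconn openF connected_open_path_connected by blast
  moreover have "q 0 \<in> F" using q(1) by (simp add: Q_def)
  ultimately obtain f where f: "path f" "path_image f \<subseteq> F" "pathstart f = p" "pathfinish f = q 0"
    using assms(4) unfolding path_connected_def by blast
  show thesis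
    by (rule that[of "f +++ g"]) (use f g gF in \<open>auto simp: path_image_join\<close>)
qed

text \<open>Walking straight from \<open>p\<close> to \<open>v\<close>, one meets the frontier of
  the component of \<open>p\<close> at a point close to \<open>v\<close>. That point is
  \<open>v\<close> or lies on the initial piece of a ray, and then \<open>arc_in_frontier\<close>
  carries the frontier along the ray back to \<open>v\<close>.\<close>

lemma star_centre_locally_accessible:
  fixes A :: "'i \<Rightarrow> complex set"
  assumes "finite I" and arcs: "\<And>i. i \<in> I \<Longrightarrow> is_arc (A i) v (w i)"
    and pw: "\<And>i j. i \<in> I \<Longrightarrow> j \<in> I \<Longrightarrow> i \<noteq> j \<Longrightarrow> A i \<inter> A j \<subseteq> {v}"
    and K0: "closed K0" "v \<notin> K0" "\<And>i. i \<in> I \<Longrightarrow> K0 \<inter> A i \<subseteq> {w i}"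
    and K: "K = insert v (K0 \<union> (\<Union>i\<in>I. A i))" and "\<delta> > 0"
  shows "\<exists>\<delta>'>0. \<forall>p\<in>ball v \<delta>' \<inter> - K. v \<in> closure (connected_component_set (ball v \<delta> \<inter> - K) p)"
proof -
  have "\<exists>x S R. is_arc S v x \<and> S \<union> R = A i \<and> S \<inter> R = {x} \<and> closed R \<and> S \<subseteq> ball v \<delta> \<and> v \<notin> R \<and> w i \<in> R"
    if i: "i \<in> I" for i
  proof -
    obtain g where g: "arc g" "pathstart g = v" "pathfinish g = w i" "path_image g = A i"
      using arcs[OF i] by (meson is_arcE)
    have g0: "g 0 = v" "g 1 = w i" using g by (auto simp: pathstart_def pathfinish_def)
    have inj: "inj_on g {0..1}" and cont: "continuous_on {0..1} g"
      using g arc_continuous by (auto simp: arc_def)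
    obtain d where d: "d > 0" "\<And>u. u \<in> {0..1} \<Longrightarrow> dist u 0 < d \<Longrightarrow> dist (g u) (g 0) < \<delta>"
      using cont[unfolded continuous_on_iff, rule_format, of 0 \<delta>] \<open>\<delta> > 0\<close> by auto
    \<comment> \<open>Cuts the ray into an initial piece \<open>S\<close> inside the ball and a far
      piece \<open>R\<close> away from \<open>v\<close>; the bound 1/2 keeps the far piece
      nondegenerate.\<close>
    define t where "t = min (1/2) (d / 2)"
    have t: "0 < t" "t < 1" "t < d" using d by (auto simp: t_def)
    have 1: "is_arc (g ` {0..t}) v (g t)" "is_arc (g ` {t..1}) (g t) (w i)"
      using is_arc_subpath[OF g(1), of 0 t] is_arc_subpath[OF g(1), of t 1] t g0 by auto
    have "{0..t} \<union> {t..1} = {0..1}" using t by auto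
    then have 2: "g ` {0..t} \<union> g ` {t..1} = A i"
      using g(4) by (metis image_Un path_image_def)
    have "g ` {0..t} \<inter> g ` {t..1} = g ` ({0..t} \<inter> {t..1})"
      by (rule inj_on_image_Int[OF inj, symmetric]) (use t in auto)
    also have "{0..t} \<inter> {t..1} = {t}" using t by auto
    finally have 3: "g ` {0..t} \<inter> g ` {t..1} = {g t}" by simp
    have 4: "g ` {0..t} \<subseteq> ball v \<delta>"
    proof
      fix z assume "z \<in> g ` {0..t}"
      then obtain u where u: "0 \<le> u" "u \<le> t" "z = g u" by auto
      then show "z \<in> ball v \<delta>" using d(2)[of u] t g0 by (simp add: dist_commute)
    qed
    have 5: "v \<notin> g ` {t..1}" using inj_onD[OF inj, of 0] t g0 by fastforce
    have 6: "w i \<in> g ` {t..1}" using g0(2) t by (intro image_eqI[of _ _ 1]) auto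
    show ?thesis
      using 1 2 3 4 5 6 is_arc_closed[OF 1(2)] by blast
  qed
  then have "\<forall>i\<in>I. \<exists>x S R. is_arc S v x \<and> S \<union> R = A i \<and> S \<inter> R = {x} \<and> closed R \<and>
      S \<subseteq> ball v \<delta> \<and> v \<notin> R \<and> w i \<in> R" by blast
  then obtain x S R where "\<forall>i\<in>I. is_arc (S i) v (x i) \<and> S i \<union> R i = A i \<and> S i \<inter> R i = {x i} \<and>
      closed (R i) \<and> S i \<subseteq> ball v \<delta> \<and> v \<notin> R i \<and> w i \<in> R i"
    unfolding bchoice_iff by blast
  then have SR: "\<And>i. i \<in> I \<Longrightarrow> is_arc (S i) v (x i)"
    "\<And>i. i \<in> I \<Longrightarrow> S i \<union> R i = A i" "\<And>i. i \<in> I \<Longrightarrow> S i \<inter> R i = {x i}"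
    "\<And>i. i \<in> I \<Longrightarrow> closed (R i)" "\<And>i. i \<in> I \<Longrightarrow> S i \<subseteq> ball v \<delta>"
    "\<And>i. i \<in> I \<Longrightarrow> v \<notin> R i" "\<And>i. i \<in> I \<Longrightarrow> w i \<in> R i"
    by blast+
  define rest where "rest = K0 \<union> (\<Union>i\<in>I. R i)"
  have clA: "closed (A i)" if "i \<in> I" for i using arcs[OF that] is_arc_closed by blast
  have clS: "closed (S i)" if "i \<in> I" for i using SR(1)[OF that] is_arc_closed by blast
  have clK: "closed K" unfolding K using assms clA by (intro closed_insert closed_Un closed_UN) auto
  have "closed rest" unfolding rest_def using assms SR by (intro closed_Un closed_UN) auto
  moreover have "v \<notin> rest" unfolding rest_def using assms SR by auto
  ultimately obtain d where d: "d > 0" "ball v d \<inter> rest = {}"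
    by (metis ComplI disjoint_eq_subset_Compl open_Compl open_contains_ball)
  define \<delta>' where "\<delta>' = min d \<delta>"
  have Keq: "K = insert v (rest \<union> (\<Union>i\<in>I. S i))"
    unfolding K rest_def using SR(2) by blast
  show ?thesis
  proof (intro exI[of _ \<delta>'] conjI ballI)
    show "\<delta>' > 0" using d assms by (simp add: \<delta>'_def)
    fix p assume p: "p \<in> ball v \<delta>' \<inter> - K"
    \<comment> \<open>Adding the sphere makes \<open>C\<close> a component of the complement of a
      closed set, the form in which \<open>arc_in_frontier\<close> can be applied.\<close>
    define K2 where "K2 = K \<union> sphere v \<delta>"
    have clK2: "closed K2" using clK by (auto simp: K2_def)
    define C where "C = connected_component_set (ball v \<delta> \<inter> - K) p"
    have pb: "p \<in> ball v \<delta> \<inter> - K" using p by (auto simp: \<delta>'_def)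
    then have CC: "C \<in> components (ball v \<delta> \<inter> - K)"
      unfolding C_def by (rule componentsI)
    have pC: "p \<in> C" using pb by (simp add: C_def)
    have Csub: "C \<subseteq> ball v \<delta> \<inter> - K" using CC in_components_subset by blast
    have Cconn: "connected C" using CC in_components_connected by blast
    have Copen: "open (ball v \<delta> \<inter> - K)" using clK by blast
    have frC: "frontier C \<subseteq> K2"
    proof -
      have "frontier C \<subseteq> frontier (ball v \<delta> \<inter> - K)" using CC frontier_of_components_subset by blast
      also have "\<dots> \<subseteq> frontier (ball v \<delta>) \<union> frontier (- K)" by (rule frontier_Int_subset)
      also have "\<dots> \<subseteq> K2"
        using \<open>\<delta> > 0\<close> clK unfolding K2_def by (auto simp: frontier_complement frontier_subset_eq[THEN iffD1] dest: subsetD[OF frontier_subset_closed])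
      finally show ?thesis .
    qed
    have C2: "C \<in> components (- K2)"
      by (rule component_if_frontier_subset) (use Cconn pC Csub frC in \<open>auto simp: K2_def\<close>)
    have "v \<in> K" by (simp add: Keq)
    then have vC: "v \<notin> C" using Csub by blast
    have "closed_segment p v \<inter> frontier C \<noteq> {}"
      by (rule connected_Int_frontier) (use pC vC in auto)
    then obtain y where y: "y \<in> closed_segment p v" "y \<in> frontier C" by blast
    have yb: "y \<in> ball v \<delta>'"
    proof -
      have "convex (ball v \<delta>')" "p \<in> ball v \<delta>'" "v \<in> ball v \<delta>'"
        using p d assms by (auto simp: \<delta>'_def)
      then show ?thesis using y closed_segment_subset by blast
    qed
    then have "y \<notin> sphere v \<delta>" "y \<notin> rest" using d by (auto simp: \<delta>'_def)
    then have "y = v \<or> (\<exists>i\<in>I. y \<in> S i)" using frC y(2) Keq by (auto simp: K2_def)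
    then have "v \<in> frontier C"
    proof
      assume "y = v" then show ?thesis using y by simp
    next
      assume "\<exists>i\<in>I. y \<in> S i"
      then obtain i where i: "i \<in> I" "y \<in> S i" by blast
      show ?thesis
      proof (cases "y = v")
        case True then show ?thesis using y by simp
      next
        case False
        have "x i \<in> rest" using SR(3)[OF i(1)] i by (auto simp: rest_def)
        then have yx: "y \<in> S i - {v, x i}" using False i \<open>y \<notin> rest\<close> by auto
        define L where "L = rest \<union> sphere v \<delta> \<union> (\<Union>j\<in>I - {i}. S j)"
        have clL: "closed L" unfolding L_def using \<open>closed rest\<close> clS \<open>finite I\<close>
          by (intro closed_Un closed_UN) auto
        have vS: "v \<in> S j" if "j \<in> I" for j using SR(1)[OF that] is_arc_ends by blast
        have K2eq: "K2 = L \<union> S i" unfolding K2_def Keq L_def using i vS by auto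
        have "L \<inter> S i \<subseteq> {v, x i}"
        proof -
          have "K0 \<inter> S i \<subseteq> {x i}"
            using K0(3)[OF i(1)] SR(2,3,7)[OF i(1)] by blast
          moreover have "R j \<inter> S i \<subseteq> {v, x i}" if "j \<in> I" for j
            using pw[OF that i(1)] SR(2)[OF i(1)] SR(2)[OF that] SR(3)[OF i(1)] by (cases "j = i") auto
          moreover have "S j \<inter> S i \<subseteq> {v}" if "j \<in> I - {i}" for j
            using pw[of j i] i that SR(2)[OF i(1)] SR(2)[of j] by auto
          moreover have "sphere v \<delta> \<inter> S i = {}" using SR(5)[OF i(1)] by auto
          ultimately show ?thesis unfolding L_def rest_def by blast
        qed
        then have "S i \<subseteq> frontier C"
          using arc_in_frontier[OF clL SR(1)[OF i(1)], of C y] C2 y(2) yx K2eq by auto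
        then show ?thesis using vS i by blast
      qed
    qed
    then show "v \<in> closure (connected_component_set (ball v \<delta> \<inter> - K) p)"
      unfolding C_def[symmetric] by (simp add: frontier_def)
  qed
qed

section \<open>Theta curves\<close>

definition theta :: "complex set \<Rightarrow> complex set \<Rightarrow> complex set \<Rightarrow> complex \<Rightarrow> complex \<Rightarrow> bool" where
  "theta P Q R a b \<longleftrightarrow> is_arc P a b \<and> is_arc Q a b \<and> is_arc R a b \<and>
     P \<inter> Q = {a, b} \<and> P \<inter> R = {a, b} \<and> Q \<inter> R = {a, b}"

lemma theta_perm: "theta P Q R a b \<Longrightarrow> theta Q P R a b" "theta P Q R a b \<Longrightarrow> theta P R Q a b"
  by (auto simp: theta_def)

lemma theta_jordan:
  assumes "theta P Q R a b"
  shows "jordan_curve (P \<union> Q)"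
  using assms jordan_curveI[of P a b Q] by (auto simp: theta_def)

text \<open>
  A point \<open>p\<close> on neither side is joined to a point \<open>q\<close> of \<open>S\<close> near \<open>x\<close> both in the complement of
  \<open>P \<union> R\<close> and, inside the ball, in that of \<open>Q \<union> R\<close>.  These sets meet in the arc \<open>R\<close>, so
  Janiszewski's theorem joins \<open>p\<close> to \<open>q\<close> off the whole theta curve.
\<close>

lemma theta_two_sided:
  assumes th: "theta P Q R a b"
    and S: "S \<in> components (- (P \<union> Q))" "S \<inter> R = {}"
    and T: "T \<in> components (- (P \<union> R))" "T \<inter> Q = {}"
    and x: "x \<in> P" and e: "ball x e \<inter> (Q \<union> R) = {}"
    and p: "p \<in> ball x e" "p \<notin> P"
  shows "p \<in> S \<union> T"
proof (rule ccontr)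
  assume np: "p \<notin> S \<union> T"
  have arcs: "is_arc P a b" "is_arc Q a b" "is_arc R a b"
    and ints: "P \<inter> Q = {a, b}" "P \<inter> R = {a, b}" "Q \<inter> R = {a, b}"
    using th by (auto simp: theta_def)
  have JQ: "jordan_curve (P \<union> Q)" using th theta_jordan by blast
  have JR: "jordan_curve (P \<union> R)" using th theta_jordan theta_perm by blast
  note SS = jordan_component_facts[OF JQ S(1)]
  note TT = jordan_component_facts[OF JR T(1)]
  have "Q - {a, b} \<noteq> {}" "connected (Q - {a, b})"
    using is_arc_open_connected[OF arcs(2)] by auto
  moreover have "(Q - {a, b}) \<inter> (P \<union> R) = {}" using ints by blast
  ultimately obtain F G where FG: "F \<in> components (- (P \<union> R))" "G \<in> components (- (P \<union> R))" "F \<noteq> G"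
      "F \<union> G = - (P \<union> R)" "Q - {a, b} \<subseteq> G" "(Q - {a, b}) \<inter> F = {}"
    using jordan_other_component[OF JR] by metis
  have "T = F"
  proof (rule ccontr)
    assume "T \<noteq> F"
    then have "T \<inter> F = {}" using components_nonoverlap[OF T(1) FG(1)] by blast
    then have "T \<inter> G \<noteq> {}" using TT(4) in_components_subset[OF T(1)] FG(4) by blast
    then have "T = G" using components_eq[OF T(1) FG(2)] by blast
    then show False using FG(5) T(2) \<open>Q - {a, b} \<noteq> {}\<close> by blast
  qed
  have pR: "p \<notin> R" "p \<notin> Q" using p e by blast+
  then have pG: "p \<in> G" using np p(2) FG(4) \<open>T = F\<close> by blast
  have xS: "x \<in> closure S" using SS(6) x by blast
  have "ball x e \<noteq> {}" using p by blast
  then have "e > 0" by simp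
  then obtain q where q: "q \<in> S" "q \<in> ball x e"
    using xS by (metis closure_approachable dist_commute mem_ball)
  \<comment> \<open>\<open>S\<close> has \<open>Q\<close> on its frontier and avoids
    \<open>R\<close>. Together with the open arc of \<open>Q\<close> it is a connected set off
    \<open>P \<union> R\<close>, hence on the side \<open>G\<close> that contains this open
    arc.\<close>
  have "connected (S \<union> (Q - {a, b}))"
  proof (rule connected_intermediate_closure[OF SS(3)])
    show "S \<union> (Q - {a, b}) \<subseteq> closure S" using SS(6) by blast
  qed blast
  moreover have "S \<union> (Q - {a, b}) \<subseteq> - (P \<union> R)" using SS(5) S(2) ints by blast
  moreover have "G \<inter> (S \<union> (Q - {a, b})) \<noteq> {}" using FG(5) \<open>Q - {a, b} \<noteq> {}\<close> by blast
  ultimately have "S \<union> (Q - {a, b}) \<subseteq> G" using components_maximal[OF FG(2)] by blast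
  then have qG: "q \<in> G" using q by blast
  have G: "connected G" "G \<subseteq> - (P \<union> R)"
    using FG(2) in_components_connected in_components_subset by blast+
  have 1: "connected_component (- (P \<union> R)) p q"
    using G pG qG unfolding connected_component_def by blast
  have 2: "connected_component (- (Q \<union> R)) p q"
    using e p q unfolding connected_component_def by (intro exI[of _ "ball x e"]) auto
  have "connected ((P \<union> R) \<inter> (Q \<union> R))"
  proof -
    have "(P \<union> R) \<inter> (Q \<union> R) = R" using ints is_arc_ends[OF arcs(3)] by blast
    then show ?thesis using is_arc_connected[OF arcs(3)] by simp
  qed
  then have "connected_component (- ((P \<union> R) \<union> (Q \<union> R))) p q"
    using is_arc_compact[OF arcs(1)] is_arc_compact[OF arcs(2)] is_arc_compact[OF arcs(3)] 1 2
    by (intro Janiszewski[OF compact_Un closed_Un] compact_imp_closed)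
  then obtain Z where Z: "connected Z" "Z \<subseteq> - ((P \<union> R) \<union> (Q \<union> R))" "p \<in> Z" "q \<in> Z"
    by (auto simp: connected_component_def)
  then have "Z \<subseteq> S" using components_maximal[OF S(1), of Z] q by blast
  then show False using Z np by blast
qed

text \<open>The sides of a theta curve are named by the arc they avoid, so that no case distinction
  between inside and outside is needed.\<close>

lemma theta_far_side:
  assumes "theta P Q R a b"
  obtains S where "S \<in> components (- (P \<union> Q))" "S \<inter> R = {}"
proof -
  have arcs: "is_arc P a b" "is_arc Q a b" "is_arc R a b"
    and ints: "P \<inter> Q = {a, b}" "P \<inter> R = {a, b}" "Q \<inter> R = {a, b}"
    using assms by (auto simp: theta_def)
  have J: "jordan_curve (P \<union> Q)" using assms theta_jordan by blast
  have "R - {a, b} \<noteq> {}" "connected (R - {a, b})"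
    using is_arc_open_connected[OF arcs(3)] by auto
  moreover have "(R - {a, b}) \<inter> (P \<union> Q) = {}" using ints by blast
  ultimately obtain F where F: "F \<in> components (- (P \<union> Q))" "(R - {a, b}) \<inter> F = {}"
    using jordan_other_component[OF J] by metis
  have "F \<inter> {a, b} = {}" using in_components_subset[OF F(1)] ints by blast
  then show thesis using that F by blast
qed

text \<open>A point of \<open>G\<close> near \<open>P\<close> puts all of \<open>G\<close> on one of
  the two sides there, and the closure of either side misses one of the other two open arcs.\<close>

theorem theta_face_misses_arc:
  assumes th: "theta P Q R a b" and G: "connected G" "G \<inter> (P \<union> Q \<union> R) = {}"
    and cl: "closure G \<inter> (P - {a, b}) \<noteq> {}" "closure G \<inter> (Q - {a, b}) \<noteq> {}"
      "closure G \<inter> (R - {a, b}) \<noteq> {}"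
  shows False
proof -
  have arcs: "is_arc P a b" "is_arc Q a b" "is_arc R a b"
    and ints: "P \<inter> Q = {a, b}" "P \<inter> R = {a, b}" "Q \<inter> R = {a, b}"
    using th by (auto simp: theta_def)
  obtain S where S: "S \<in> components (- (P \<union> Q))" "S \<inter> R = {}" using theta_far_side[OF th] .
  obtain T where T: "T \<in> components (- (P \<union> R))" "T \<inter> Q = {}"
    using theta_far_side[OF theta_perm(2)[OF th]] .
  obtain x where x: "x \<in> closure G" "x \<in> P" "x \<noteq> a" "x \<noteq> b" using cl by blast
  have "closed (Q \<union> R)" using arcs is_arc_closed by blast
  moreover have "x \<notin> Q \<union> R" using x ints by blast
  ultimately obtain e where e: "e > 0" "ball x e \<inter> (Q \<union> R) = {}"
    by (metis ComplI disjoint_eq_subset_Compl open_Compl open_contains_ball)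
  obtain p where p: "p \<in> G" "p \<in> ball x e"
    using x e by (metis closure_approachable dist_commute mem_ball)
  have JQ: "jordan_curve (P \<union> Q)" using th theta_jordan by blast
  have JR: "jordan_curve (P \<union> R)" using th theta_jordan theta_perm by blast
  have "p \<in> S \<union> T" using theta_two_sided[OF th S T x(2) e(2) p(2)] p G by blast
  then show False
  proof
    assume "p \<in> S"
    then have "G \<subseteq> S" using components_maximal[OF S(1) G(1)] p G by blast
    then have "closure G \<subseteq> S \<union> (P \<union> Q)"
      using jordan_component_facts(6)[OF JQ S(1)] closure_mono by metis
    then show False using cl(3) S(2) ints by blast
  next
    assume "p \<in> T"
    then have "G \<subseteq> T" using components_maximal[OF T(1) G(1)] p G by blast
    then have "closure G \<subseteq> T \<union> (P \<union> R)"
      using jordan_component_facts(6)[OF JR T(1)] closure_mono by metis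
    then show False using cl(2) T(2) ints by blast
  qed
qed

section \<open>Faces of plane graphs\<close>

abbreviation img :: "'a drawing \<Rightarrow> 'a set \<Rightarrow> complex set" where
  "img D e \<equiv> path_image (curve D e)"

definition drawn :: "'a drawing \<Rightarrow> complex set" where
  "drawn D = point D ` vertices D \<union> (\<Union>e\<in>edges D. img D e)"

lemma plane_graph_finite:
  assumes "plane_graph D"
  shows "finite (vertices D)" "finite (edges D)"
proof -
  have "simple_graph (vertices D) (edges D)" using assms by (simp add: plane_graph_def)
  then have "finite (vertices D)" "edges D \<subseteq> Pow (vertices D)" by (auto simp: simple_graph_def)
  then show "finite (vertices D)" "finite (edges D)" using finite_subset by blast+
qed

lemma plane_graph_edgeE:
  assumes "plane_graph D" "e \<in> edges D"
  obtains u v where "e = {u, v}" "u \<noteq> v" "u \<in> vertices D" "v \<in> vertices D"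
proof -
  have "e \<subseteq> vertices D" "card e = 2" using assms by (auto simp: plane_graph_def simple_graph_def)
  then show thesis using that by (metis card_2_iff insert_subset)
qed

lemma plane_graph_edge_ends:
  assumes "plane_graph D" "{u, v} \<in> edges D"
  shows "u \<noteq> v" "u \<in> vertices D" "v \<in> vertices D"
  using plane_graph_edgeE[OF assms] by (metis doubleton_eq_iff)+

lemma plane_graph_point_eq:
  "plane_graph D \<Longrightarrow> u \<in> vertices D \<Longrightarrow> v \<in> vertices D \<Longrightarrow> point D u = point D v \<longleftrightarrow> u = v"
  by (auto simp: plane_graph_def inj_on_def)

lemma plane_graph_arc:
  assumes "plane_graph D" "{u, v} \<in> edges D"
  shows "is_arc (img D {u, v}) (point D u) (point D v)"
proof -
  have "arc (curve D {u, v})" "{pathstart (curve D {u, v}), pathfinish (curve D {u, v})} = {point D u, point D v}"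
    using assms unfolding plane_graph_def by (metis, metis image_empty image_insert)
  then have "is_arc (img D {u, v}) (point D u) (point D v) \<or> is_arc (img D {u, v}) (point D v) (point D u)"
    unfolding is_arc_def by (metis doubleton_eq_iff)
  then show ?thesis using is_arc_sym by blast
qed

lemma plane_graph_on_edge:
  assumes "plane_graph D" "e \<in> edges D" "v \<in> vertices D"
  shows "point D v \<in> img D e \<longleftrightarrow> v \<in> e"
proof
  show "point D v \<in> img D e \<Longrightarrow> v \<in> e" using assms by (auto simp: plane_graph_def)
  assume "v \<in> e"
  then obtain u where "e = {u, v}" using plane_graph_edgeE[OF assms(1,2)] by (metis insert_commute insertE singletonD)
  then show "point D v \<in> img D e"
    using plane_graph_arc[of D u v] assms is_arc_ends by blast
qed

lemma plane_graph_edges_disjoint: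
  assumes "plane_graph D" "e \<in> edges D" "f \<in> edges D" "e \<noteq> f"
  shows "img D e \<inter> img D f \<subseteq> point D ` (e \<inter> f)"
  using assms unfolding plane_graph_def by blast

lemma plane_graph_adjacent_inter:
  assumes "plane_graph D" "{a, b} \<in> edges D" "{b, c} \<in> edges D" "a \<noteq> c"
  shows "img D {a, b} \<inter> img D {b, c} \<subseteq> {point D b}"
proof -
  have "a \<noteq> b" using plane_graph_edge_ends assms by metis
  then have "{a, b} \<noteq> {b, c}" "{a, b} \<inter> {b, c} = {b}" using assms(4) by (auto simp: doubleton_eq_iff)
  then show ?thesis using plane_graph_edges_disjoint[OF assms(1-3)] by auto
qed

lemma plane_graph_path2:
  assumes "plane_graph D" "{a, b} \<in> edges D" "{b, c} \<in> edges D" "a \<noteq> c"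
  shows "is_arc (img D {a, b} \<union> img D {b, c}) (point D a) (point D c)"
  using is_arc_join plane_graph_arc plane_graph_adjacent_inter assms by metis

lemma closed_edges:
  assumes "plane_graph D" "E \<subseteq> edges D"
  shows "closed (\<Union>e\<in>E. img D e)"
proof (intro closed_UN)
  show "finite E" using assms plane_graph_finite finite_subset by blast
  show "\<forall>e\<in>E. closed (img D e)"
    using assms by (auto simp: plane_graph_def closed_arc_image)
qed

lemma closed_points: "plane_graph D \<Longrightarrow> V \<subseteq> vertices D \<Longrightarrow> closed (point D ` V)"
  by (meson finite_imageI finite_imp_closed finite_subset plane_graph_finite(1))

lemma closed_drawn: "plane_graph D \<Longrightarrow> closed (drawn D)"
  unfolding drawn_def using closed_edges closed_points by blast

lemma edge_in_frontier:
  assumes D: "plane_graph D" and F: "F \<in> components (- drawn D)"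
    and e: "e \<in> edges D" and x: "x \<in> img D e" "x \<in> frontier F" "x \<notin> point D ` vertices D"
  shows "img D e \<subseteq> frontier F"
proof -
  obtain u v where uv: "e = {u, v}" "u \<noteq> v" "u \<in> vertices D" "v \<in> vertices D"
    using plane_graph_edgeE[OF D e] .
  define K where "K = point D ` vertices D \<union> (\<Union>f\<in>edges D - {e}. img D f)"
  have "closed K" unfolding K_def using closed_points[OF D] closed_edges[OF D] by (intro closed_Un) auto
  moreover have arc: "is_arc (img D e) (point D u) (point D v)" using plane_graph_arc D e uv by metis
  moreover have "K \<inter> img D e \<subseteq> {point D u, point D v}"
  proof
    fix z assume z: "z \<in> K \<inter> img D e"
    then consider w where "w \<in> vertices D" "z = point D w" | f where "f \<in> edges D" "f \<noteq> e" "z \<in> img D f"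
      unfolding K_def by blast
    then show "z \<in> {point D u, point D v}"
    proof cases
      case 1 then show ?thesis using plane_graph_on_edge[OF D e] z uv by auto
    next
      case 2 then show ?thesis using plane_graph_edges_disjoint[OF D 2(1) e 2(2)] z uv by auto
    qed
  qed
  moreover have "drawn D = K \<union> img D e" unfolding drawn_def K_def using e by blast
  ultimately show ?thesis
    using arc_in_frontier[of K "img D e" "point D u" "point D v" F x] F x uv by auto
qed

text \<open>The edges at \<open>v\<close> form a finite star, and all other vertices and edges form
  a closed set that meets each ray at most in its far end: the situation of
  \<open>star_centre_locally_accessible\<close>.\<close>

lemma vertex_accessible:
  assumes D: "plane_graph D" and F: "F \<in> components (- drawn D)"
    and v: "v \<in> vertices D" "point D v \<in> frontier F" and p: "p \<in> F"
  obtains g where "path g" "pathstart g = p" "pathfinish g = point D v"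
    "path_image g \<subseteq> insert (point D v) F"
proof -
  define I where "I = {e \<in> edges D. v \<in> e}"
  have "\<exists>u. e = {v, u} \<and> u \<noteq> v" if "e \<in> I" for e
  proof -
    have e: "e \<in> edges D" "v \<in> e" using that by (auto simp: I_def)
    obtain x y where xy: "e = {x, y}" "x \<noteq> y" using plane_graph_edgeE[OF D e(1)] .
    then have "e = {v, if v = x then y else x}" "(if v = x then y else x) \<noteq> v" using e(2) by auto
    then show ?thesis by blast
  qed
  then obtain w where w: "\<And>e. e \<in> I \<Longrightarrow> e = {v, w e} \<and> w e \<noteq> v" by metis
  define K where "K = point D ` (vertices D - {v}) \<union> (\<Union>e\<in>edges D - I. img D e)"
  have K: "closed K" unfolding K_def using closed_points[OF D] closed_edges[OF D] by (intro closed_Un) auto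
  have vK: "point D v \<notin> K"
    using plane_graph_on_edge[OF D _ v(1)] plane_graph_point_eq[OF D] v unfolding K_def I_def by auto
  have KA: "K \<inter> img D e \<subseteq> {point D (w e)}" if e: "e \<in> I" for e
  proof
    fix z assume z: "z \<in> K \<inter> img D e"
    have eD: "e \<in> edges D" using e by (simp add: I_def)
    from z consider u where "u \<in> vertices D" "u \<noteq> v" "z = point D u"
      | f where "f \<in> edges D" "v \<notin> f" "z \<in> img D f" unfolding K_def I_def by blast
    then show "z \<in> {point D (w e)}"
    proof cases
      case 1 then show ?thesis using plane_graph_on_edge[OF D eD] z w[OF e] by auto
    next
      case 2
      then have "z \<in> point D ` (f \<inter> e)"
        using plane_graph_edges_disjoint[OF D 2(1) eD] z e unfolding I_def by blast
      then show ?thesis using w[OF e] 2(2) by auto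
    qed
  qed
  have pw: "img D e \<inter> img D f \<subseteq> {point D v}" if "e \<in> I" "f \<in> I" "e \<noteq> f" for e f
  proof -
    have "e \<inter> f = {v}" using w[OF that(1)] w[OF that(2)] that(3) by auto
    then show ?thesis using plane_graph_edges_disjoint[OF D, of e f] that by (auto simp: I_def)
  qed
  have arcs: "is_arc (img D e) (point D v) (point D (w e))" if "e \<in> I" for e
    using plane_graph_arc[OF D, of v "w e"] w[OF that] that by (simp add: I_def)
  have eq: "drawn D = insert (point D v) (K \<union> (\<Union>e\<in>I. img D e))"
    unfolding drawn_def K_def I_def using v(1) by blast
  have "finite I" unfolding I_def using plane_graph_finite(2)[OF D] by simp
  have loc: "\<exists>\<delta>'>0. \<forall>q\<in>ball (point D v) \<delta>' \<inter> - drawn D.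
        point D v \<in> closure (connected_component_set (ball (point D v) \<delta> \<inter> - drawn D) q)" if "\<delta> > 0" for \<delta>
    by (rule star_centre_locally_accessible[OF \<open>finite I\<close> arcs pw K vK KA eq that])
  have op: "open (- drawn D)" using closed_drawn[OF D] by blast
  have "point D v \<in> closure F" using v(2) by (simp add: frontier_def)
  from accessible_if_locally[OF op F this p loc] that show thesis by blast
qed

lemma plane_graph_add_edge:
  assumes D: "plane_graph D" and uv: "u \<in> vertices D" "v \<in> vertices D" "u \<noteq> v" "{u, v} \<notin> edges D"
    and g: "arc g" "pathstart g = point D u" "pathfinish g = point D v"
      "path_image g \<inter> drawn D \<subseteq> {point D u, point D v}"
  shows "plane_graph (D\<lparr>edges := insert {u, v} (edges D), curve := (curve D)({u, v} := g)\<rparr>)"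
    (is "plane_graph ?D")
  unfolding plane_graph_def
proof (intro conjI)
  have "simple_graph (vertices D) (edges D)" using D by (simp add: plane_graph_def)
  then show "simple_graph (vertices ?D) (edges ?D)" using uv by (auto simp: simple_graph_def)
  show "inj_on (point ?D) (vertices ?D)" using D by (simp add: plane_graph_def)
  show "\<forall>e\<in>edges ?D. arc (curve ?D e) \<and> {pathstart (curve ?D e), pathfinish (curve ?D e)} = point ?D ` e"
    using D g by (auto simp: plane_graph_def)
  show "\<forall>e\<in>edges ?D. \<forall>w\<in>vertices ?D. point ?D w \<in> path_image (curve ?D e) \<longrightarrow> w \<in> e"
  proof (intro ballI impI)
    fix e w assume e: "e \<in> edges ?D" and w: "w \<in> vertices ?D" "point ?D w \<in> path_image (curve ?D e)"
    show "w \<in> e"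
    proof (cases "e = {u, v}")
      case True
      then have "point D w \<in> path_image g \<inter> drawn D" using w by (simp add: drawn_def)
      then have "point D w = point D u \<or> point D w = point D v" using g(4) by blast
      then show ?thesis using True plane_graph_point_eq[OF D] w(1) uv by auto
    next
      case False
      then show ?thesis using plane_graph_on_edge[OF D, of e w] e w by auto
    qed
  qed
  have new: "path_image g \<inter> img D f \<subseteq> point D ` ({u, v} \<inter> f)" if f: "f \<in> edges D" for f
  proof
    fix z assume z: "z \<in> path_image g \<inter> img D f"
    then have "z \<in> drawn D" using f by (auto simp: drawn_def)
    then have "z \<in> {point D u, point D v}" using g(4) z by blast
    then show "z \<in> point D ` ({u, v} \<inter> f)"
      using plane_graph_on_edge[OF D f] z uv by auto
  qed
  show "\<forall>e\<in>edges ?D. \<forall>f\<in>edges ?D. e \<noteq> f \<longrightarrow> img ?D e \<inter> img ?D f \<subseteq> point ?D ` (e \<inter> f)"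
  proof (intro ballI impI)
    fix e f assume ef: "e \<in> edges ?D" "f \<in> edges ?D" "e \<noteq> f"
    consider "e = {u, v}" "f \<in> edges D" "f \<noteq> {u, v}" | "f = {u, v}" "e \<in> edges D" "e \<noteq> {u, v}"
      | "e \<in> edges D" "f \<in> edges D" "e \<noteq> {u, v}" "f \<noteq> {u, v}" using ef by auto
    then show "img ?D e \<inter> img ?D f \<subseteq> point ?D ` (e \<inter> f)"
    proof cases
      case 1 then show ?thesis using new[OF 1(2)] by simp
    next
      case 2 then show ?thesis using new[OF 2(2)] by (simp add: Int_commute)
    next
      case 3 then show ?thesis using plane_graph_edges_disjoint[OF D 3(1,2) ef(3)] by simp
    qed
  qed
qed

section \<open>Faces of a maximal plane graph\<close>

lemma face_vertices_adjacent:
  assumes tri: "planar_triangulation (vertices D) (edges D)" and D: "plane_graph D"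
    and F: "F \<in> components (- drawn D)"
    and uv: "u \<in> vertices D" "v \<in> vertices D" "u \<noteq> v"
      "point D u \<in> frontier F" "point D v \<in> frontier F"
  shows "{u, v} \<in> edges D"
proof (rule ccontr)
  assume ne: "{u, v} \<notin> edges D"
  note FF = component_facts[OF closed_drawn[OF D] F]
  obtain p where p: "p \<in> F" using FF by blast
  obtain f where f: "path f" "pathstart f = p" "pathfinish f = point D u" "path_image f \<subseteq> insert (point D u) F"
    using vertex_accessible[OF D F uv(1,4) p] .
  obtain g where g: "path g" "pathstart g = p" "pathfinish g = point D v" "path_image g \<subseteq> insert (point D v) F"
    using vertex_accessible[OF D F uv(2,5) p] .
  \<comment> \<open>The two access paths may cross each other inside \<open>F\<close>, so their join
    is only a path; the new edge is an arc contained in it.\<close>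
  define h where "h = reversepath f +++ g"
  have h: "path h" "pathstart h = point D u" "pathfinish h = point D v"
    "path_image h \<subseteq> {point D u, point D v} \<union> F"
    unfolding h_def using f g by (auto simp: path_image_join)
  have "point D u \<noteq> point D v" using plane_graph_point_eq[OF D] uv by blast
  then obtain a where a: "arc a" "path_image a \<subseteq> path_image h" "pathstart a = point D u" "pathfinish a = point D v"
    using path_contains_arc[OF h(1-3)] by metis
  have "path_image a \<inter> drawn D \<subseteq> {point D u, point D v}" using a(2) h(4) FF(4) by blast
  from plane_graph_add_edge[OF D uv(1-3) ne a(1,3,4) this]
  have "planar (vertices D) (insert {u, v} (edges D))" unfolding planar_def by force
  then have "insert {u, v} (edges D) = edges D"
    using tri unfolding planar_triangulation_def by blast
  then show False using ne by blast
qed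

lemma connected_complement_finite:
  fixes P :: "complex set"
  assumes "finite P"
  shows "connected (- P)"
  using connected_open_delete_finite[of "UNIV :: complex set" P] assms connected_UNIV by (simp add: Compl_eq_Diff_UNIV)

text \<open>The edge and the two detours through \<open>c\<close> and \<open>d\<close> form a theta
  curve. The vertices \<open>c\<close> and \<open>d\<close> are interior points of two of its arcs,
  so with both of them touched the third open arc, the edge itself, must be missed.\<close>

lemma K4_edge_missed:
  assumes D: "plane_graph D" and dist: "distinct [a, b, c, d]"
    and E: "{a, b} \<in> edges D" "{a, c} \<in> edges D" "{c, b} \<in> edges D" "{a, d} \<in> edges D" "{d, b} \<in> edges D"
    and G: "connected G" "G \<inter> (img D {a, b} \<union> (img D {a, c} \<union> img D {c, b}) \<union> (img D {a, d} \<union> img D {d, b})) = {}"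
    and cl: "point D c \<in> closure G" "point D d \<in> closure G"
  shows "closure G \<inter> img D {a, b} \<subseteq> {point D a, point D b}"
proof (rule ccontr)
  assume "\<not> closure G \<inter> img D {a, b} \<subseteq> {point D a, point D b}"
  then have ne: "closure G \<inter> (img D {a, b} - {point D a, point D b}) \<noteq> {}" by blast
  have d: "a \<noteq> b" "a \<noteq> c" "a \<noteq> d" "b \<noteq> c" "b \<noteq> d" "c \<noteq> d" using dist by auto
  have V: "a \<in> vertices D" "b \<in> vertices D" "c \<in> vertices D" "d \<in> vertices D"
    using plane_graph_edge_ends[OF D E(1)] plane_graph_edge_ends[OF D E(2)] plane_graph_edge_ends[OF D E(4)] by auto
  note P1 = plane_graph_arc[OF D E(1)]
  note P2 = plane_graph_path2[OF D E(2,3) d(1)]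
  note P3 = plane_graph_path2[OF D E(4,5) d(1)]
  have int: "img D e \<inter> img D f \<subseteq> {point D a, point D b}"
    if "e \<in> edges D" "f \<in> edges D" "e \<noteq> f" "e \<inter> f \<subseteq> {a, b}" for e f
    using plane_graph_edges_disjoint[OF D that(1-3)] that(4) by auto
  have "theta (img D {a, b}) (img D {a, c} \<union> img D {c, b}) (img D {a, d} \<union> img D {d, b}) (point D a) (point D b)"
    unfolding theta_def
  proof (intro conjI P1 P2 P3 subset_antisym)
    show "img D {a, b} \<inter> (img D {a, c} \<union> img D {c, b}) \<subseteq> {point D a, point D b}"
      using int[OF E(1,2)] int[OF E(1,3)] d by (auto simp: doubleton_eq_iff)
    show "img D {a, b} \<inter> (img D {a, d} \<union> img D {d, b}) \<subseteq> {point D a, point D b}"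
      using int[OF E(1,4)] int[OF E(1,5)] d by (auto simp: doubleton_eq_iff)
    show "(img D {a, c} \<union> img D {c, b}) \<inter> (img D {a, d} \<union> img D {d, b}) \<subseteq> {point D a, point D b}"
      using int[OF E(2,4)] int[OF E(2,5)] int[OF E(3,4)] int[OF E(3,5)] d by (auto simp: doubleton_eq_iff)
  qed (use is_arc_ends[OF P1] is_arc_ends[OF P2] is_arc_ends[OF P3] in auto)
  moreover have "point D c \<in> (img D {a, c} \<union> img D {c, b}) - {point D a, point D b}"
    "point D d \<in> (img D {a, d} \<union> img D {d, b}) - {point D a, point D b}"
    using plane_graph_on_edge[OF D E(2) V(3)] plane_graph_on_edge[OF D E(4) V(4)]
      plane_graph_point_eq[OF D] V d by auto
  ultimately show False
    using theta_face_misses_arc[OF _ G ne] cl by blast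
qed

text \<open>Each of the six edges is touched at most at its ends, so the face of the K4 drawing that
  contains \<open>F\<close> has a frontier of at most four points. Finitely many points do not
  separate the plane, and the face would swallow the edges.\<close>

lemma K4_not_outerplanar:
  assumes D: "plane_graph D" and dist: "distinct [a, b, c, d]"
    and E: "{a, b} \<in> edges D" "{a, c} \<in> edges D" "{a, d} \<in> edges D"
       "{b, c} \<in> edges D" "{b, d} \<in> edges D" "{c, d} \<in> edges D"
    and F: "connected F" "F \<noteq> {}" "F \<inter> drawn D = {}"
    and cl: "point D a \<in> closure F" "point D b \<in> closure F" "point D c \<in> closure F" "point D d \<in> closure F"
  shows False
proof -
  define K where "K = img D {a, b} \<union> img D {a, c} \<union> img D {a, d} \<union> img D {b, c} \<union> img D {b, d} \<union> img D {c, d}"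
  define P where "P = {point D a, point D b, point D c, point D d}"
  have "K = (\<Union>e\<in>{{a, b}, {a, c}, {a, d}, {b, c}, {b, d}, {c, d}}. img D e)"
    unfolding K_def by auto
  then have Kcl: "closed K" using closed_edges[OF D] E by (metis (no_types, lifting) empty_subsetI insert_subset)
  have "F \<inter> K = {}" using F(3) E unfolding K_def drawn_def by blast
  then obtain G where G: "G \<in> components (- K)" "F \<subseteq> G"
    using exists_component_superset[of F "- K"] F by blast
  note GG = component_facts[OF Kcl G(1)]
  have clG: "point D a \<in> closure G" "point D b \<in> closure G" "point D c \<in> closure G" "point D d \<in> closure G"
    using cl closure_mono[OF G(2)] by auto
  note com = insert_commute[of b a "{}"] insert_commute[of c a "{}"] insert_commute[of d a "{}"]
    insert_commute[of c b "{}"] insert_commute[of d b "{}"] insert_commute[of d c "{}"]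
  have K: "img D {a, b} \<inter> G = {}" "img D {a, c} \<inter> G = {}" "img D {a, d} \<inter> G = {}" "img D {b, c} \<inter> G = {}"
    "img D {b, d} \<inter> G = {}" "img D {c, d} \<inter> G = {}" using GG(4) unfolding K_def by blast+
  note miss = K4_edge_missed[OF D _ _ _ _ _ _ GG(2)]
  have "closure G \<inter> K \<subseteq> P"
  proof -
    have "closure G \<inter> img D {a, b} \<subseteq> {point D a, point D b}"
      by (rule miss[of _ _ c d]) (use dist E clG K com in auto)
    moreover have "closure G \<inter> img D {a, c} \<subseteq> {point D a, point D c}"
      by (rule miss[of _ _ b d]) (use dist E clG K com in auto)
    moreover have "closure G \<inter> img D {a, d} \<subseteq> {point D a, point D d}"
      by (rule miss[of _ _ b c]) (use dist E clG K com in auto)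
    moreover have "closure G \<inter> img D {b, c} \<subseteq> {point D b, point D c}"
      by (rule miss[of _ _ a d]) (use dist E clG K com in auto)
    moreover have "closure G \<inter> img D {b, d} \<subseteq> {point D b, point D d}"
      by (rule miss[of _ _ a c]) (use dist E clG K com in auto)
    moreover have "closure G \<inter> img D {c, d} \<subseteq> {point D c, point D d}"
      by (rule miss[of _ _ a b]) (use dist E clG K com in auto)
    ultimately show ?thesis unfolding P_def K_def Int_Un_distrib by (intro Un_least) auto
  qed
  moreover have frK: "frontier G \<subseteq> closure G \<inter> K" using GG(5) by (auto simp: frontier_def)
  ultimately have frP: "frontier G \<subseteq> P" by blast
  have "P \<subseteq> K"
    using is_arc_ends[OF plane_graph_arc[OF D E(1)]] is_arc_ends[OF plane_graph_arc[OF D E(6)]]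
    unfolding P_def K_def by blast
  then have "G \<inter> P = {}" using GG(4) by blast
  then have GP: "G \<in> components (- P)" using component_if_frontier_subset[OF GG(2,3) _ frP] by blast
  have "finite P" by (simp add: P_def)
  then have "connected (- P)"
    by (rule connected_complement_finite)
  then have "G = - P" using GP by (metis components_eq_sing_iff components_eq_empty empty_iff singletonD)
  then have "img D {a, b} \<subseteq> P" using K(1) by blast
  then show False
    using is_arc_infinite[OF plane_graph_arc[OF D E(1)]] \<open>finite P\<close> finite_subset by blast
qed

definition triangle :: "'a drawing \<Rightarrow> 'a \<Rightarrow> 'a \<Rightarrow> 'a \<Rightarrow> complex set" where
  "triangle D a b c = img D {a, b} \<union> img D {b, c} \<union> img D {a, c}"

lemma triangle_jordan:
  assumes D: "plane_graph D" and E: "{a, b} \<in> edges D" "{b, c} \<in> edges D" "{a, c} \<in> edges D"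
  shows "jordan_curve (triangle D a b c)"
proof -
  have d: "a \<noteq> b" "b \<noteq> c" "a \<noteq> c" using plane_graph_edge_ends[OF D] E by metis+
  have "img D {a, b} \<inter> img D {a, c} \<subseteq> {point D a}" "img D {b, c} \<inter> img D {a, c} \<subseteq> {point D c}"
    using plane_graph_adjacent_inter[OF D, of b a c] plane_graph_adjacent_inter[OF D, of b c a] E d
    by (simp_all add: insert_commute)
  then show ?thesis
    unfolding triangle_def
    using plane_graph_path2[OF D E(1,2) d(3)] plane_graph_arc[OF D E(3)]
    by (intro jordan_curveI) auto
qed

lemma face_frontier_subset:
  assumes D: "plane_graph D" and F: "F \<in> components (- drawn D)"
  defines "W \<equiv> {v \<in> vertices D. point D v \<in> frontier F}"
  shows "frontier F \<subseteq> point D ` W \<union> (\<Union>e\<in>{e \<in> edges D. e \<subseteq> W}. img D e)"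
proof
  fix x assume x: "x \<in> frontier F"
  have "x \<in> drawn D" using component_facts(5)[OF closed_drawn[OF D] F] x by blast
  show "x \<in> point D ` W \<union> (\<Union>e\<in>{e \<in> edges D. e \<subseteq> W}. img D e)"
  proof (cases "x \<in> point D ` vertices D")
    case True then show ?thesis using x by (auto simp: W_def)
  next
    case False
    then obtain e where e: "e \<in> edges D" "x \<in> img D e" using \<open>x \<in> drawn D\<close> by (auto simp: drawn_def)
    have sub: "img D e \<subseteq> frontier F" using edge_in_frontier[OF D F e x False] .
    have "e \<subseteq> W"
    proof
      fix v assume v: "v \<in> e"
      then have "v \<in> vertices D" using e plane_graph_edgeE[OF D] by blast
      then show "v \<in> W" using plane_graph_on_edge[OF D e(1)] v sub by (auto simp: W_def)
    qed
    then show ?thesis using e by blast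
  qed
qed

theorem triangulation_face:
  assumes tri: "planar_triangulation (vertices D) (edges D)" and n: "card (vertices D) \<ge> 3"
    and D: "plane_graph D" and F: "F \<in> components (- drawn D)"
  obtains a b c where "{a, b} \<in> edges D" "{b, c} \<in> edges D" "{a, c} \<in> edges D"
    "frontier F = triangle D a b c" "F \<in> components (- triangle D a b c)"
proof -
  define W where "W = {v \<in> vertices D. point D v \<in> frontier F}"
  \<comment> \<open>\<open>A\<close> collects the vertices and edges that can occur on the frontier
    of \<open>F\<close>. It replaces the whole drawing, since \<open>F\<close> stays a component of
    its complement.\<close>
  define A where "A = point D ` W \<union> (\<Union>e\<in>{e \<in> edges D. e \<subseteq> W}. img D e)"
  note FF = component_facts[OF closed_drawn[OF D] F]
  have W: "finite W" "W \<subseteq> vertices D" using plane_graph_finite(1)[OF D] by (auto simp: W_def)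
  have adj: "{u, v} \<in> edges D" if "u \<in> W" "v \<in> W" "u \<noteq> v" for u v
    using face_vertices_adjacent[OF tri D F] that by (auto simp: W_def)
  have clW: "point D v \<in> closure F" if "v \<in> W" for v using that by (auto simp: W_def frontier_def)
  have frA: "frontier F \<subseteq> A" using face_frontier_subset[OF D F] by (simp add: A_def W_def)
  have "A \<subseteq> drawn D" using W unfolding A_def drawn_def by blast
  then have FA: "F \<in> components (- A)"
    using component_if_frontier_subset[OF FF(2,3) _ frA] FF(4) by blast
  have "\<not> card W \<ge> 4"
  proof
    assume "card W \<ge> 4"
    then obtain U where U: "U \<subseteq> W" "card U = 4" using obtain_subset_with_card_n by metis
    then have "card U = Suc (Suc (Suc (Suc 0)))" by simp
    then obtain a b c d where "U = {a, b, c, d}" "distinct [a, b, c, d]"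
      by (auto simp: card_Suc_eq)
    then have "distinct [a, b, c, d]" "a \<in> W" "b \<in> W" "c \<in> W" "d \<in> W" using U by auto
    then show False using K4_not_outerplanar[OF D _ _ _ _ _ _ _ FF(2,3,4), of a b c d] adj clW by auto
  qed
  \<comment> \<open>With so few vertices \<open>A\<close> is a single edge or a finite set and does
    not separate the plane, so \<open>F\<close> is all of \<open>- A\<close>. A vertex outside
    \<open>W\<close>, which exists because there are at least three, then has no place left.\<close>
  moreover have "\<not> card W \<le> 2"
  proof
    assume le: "card W \<le> 2"
    have "connected (- A)"
    proof (cases "card W = 2")
      case True
      then obtain u v where uv: "W = {u, v}" "u \<noteq> v" by (auto simp: card_2_iff)
      have e: "{u, v} \<in> edges D" using adj uv by auto
      have "e = {u, v}" if "e \<in> edges D" "e \<subseteq> W" for e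
        using plane_graph_edgeE[OF D that(1)] that(2) uv by (metis insertE insert_commute insert_subset singletonD)
      then have "A = point D ` W \<union> img D {u, v}" unfolding A_def using e uv by auto
      then have "A = img D {u, v}" using is_arc_ends[OF plane_graph_arc[OF D e]] uv by auto
      then show ?thesis using is_arc_complement[OF plane_graph_arc[OF D e]] by simp
    next
      case False
      then have "card W \<le> 1" using le by linarith
      have "\<not> e \<subseteq> W" if "e \<in> edges D" for e
      proof
        assume "e \<subseteq> W"
        moreover have "card e = 2" using D that by (simp add: plane_graph_def simple_graph_def)
        ultimately show False using card_mono[OF W(1), of e] \<open>card W \<le> 1\<close> by simp
      qed
      then have "A = point D ` W" unfolding A_def by auto
      then have "finite A" using W by simp
      then show ?thesis
        by (rule connected_complement_finite)
    qed
    then have "F = - A" using FA by (metis components_eq_sing_iff components_eq_empty empty_iff singletonD)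
    have "card W < card (vertices D)" using le n by linarith
    then have "W \<noteq> vertices D" by blast
    then obtain v where v: "v \<in> vertices D" "v \<notin> W" using W by blast
    have "point D v \<notin> F" using FF(4) v by (auto simp: drawn_def)
    then have "point D v \<in> A" using \<open>F = - A\<close> by blast
    then consider w where "w \<in> W" "point D v = point D w" | e where "e \<in> edges D" "e \<subseteq> W" "point D v \<in> img D e"
      unfolding A_def by blast
    then show False
    proof cases
      case 1 then show ?thesis using plane_graph_point_eq[OF D] v W by blast
    next
      case 2 then show ?thesis using plane_graph_on_edge[OF D] v by blast
    qed
  qed
  ultimately have "card W = 3" by linarith
  then obtain a b c where abc: "W = {a, b, c}" "a \<noteq> b" "b \<noteq> c" "a \<noteq> c"
    by (auto simp: card_3_iff)
  have E: "{a, b} \<in> edges D" "{b, c} \<in> edges D" "{a, c} \<in> edges D" using adj abc by auto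
  have "A \<subseteq> triangle D a b c"
  proof -
    have "point D ` W \<subseteq> triangle D a b c"
      using abc is_arc_ends[OF plane_graph_arc[OF D E(1)]] is_arc_ends[OF plane_graph_arc[OF D E(2)]]
      unfolding triangle_def by auto
    moreover have "img D e \<subseteq> triangle D a b c" if e: "e \<in> edges D" "e \<subseteq> W" for e
    proof -
      obtain u v where "e = {u, v}" "u \<noteq> v" using plane_graph_edgeE[OF D e(1)] .
      then have "e = {a, b} \<or> e = {b, c} \<or> e = {a, c}" using e(2) abc by auto
      then show ?thesis by (auto simp: triangle_def)
    qed
    ultimately show ?thesis unfolding A_def by blast
  qed
  moreover have "triangle D a b c \<subseteq> drawn D" unfolding triangle_def drawn_def using E by blast
  ultimately have "F \<in> components (- triangle D a b c)"
    using component_if_frontier_subset[OF FF(2,3), of "triangle D a b c"] FF(4) frA by blast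
  moreover from this have "frontier F = triangle D a b c"
    using jordan_component_facts(1)[OF triangle_jordan[OF D E]] by blast
  ultimately show thesis using that E by blast
qed

section \<open>Faces of a triangulation\<close>

text \<open>The longest path argument: all neighbours of the head of a longest path lie on the path,
  and one of two distinct neighbours is far enough away to close a cycle.\<close>

lemma cycle_if_two_neighbours:
  fixes R :: "'b \<Rightarrow> 'b \<Rightarrow> bool"
  assumes "finite X" "X \<noteq> {}" and sym: "\<And>x y. R x y \<Longrightarrow> R y x"
    and nb: "\<And>x. x \<in> X \<Longrightarrow> \<exists>y\<in>X. \<exists>z\<in>X. y \<noteq> z \<and> y \<noteq> x \<and> z \<noteq> x \<and> R x y \<and> R x z"
  obtains vs where "distinct vs" "length vs \<ge> 3" "set vs \<subseteq> X"
    "\<And>i. i < length vs \<Longrightarrow> R (vs ! i) (vs ! (Suc i mod length vs))"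
proof -
  define P where "P vs \<longleftrightarrow> distinct vs \<and> vs \<noteq> [] \<and> set vs \<subseteq> X \<and>
    (\<forall>i. Suc i < length vs \<longrightarrow> R (vs ! i) (vs ! Suc i))" for vs
  obtain x0 where "x0 \<in> X" using assms(2) by blast
  then have "P [x0]" by (simp add: P_def)
  moreover have "\<forall>vs. P vs \<longrightarrow> length vs < Suc (card X)"
    using assms(1) by (auto simp: P_def less_Suc_eq_le) (metis card_mono distinct_card)
  ultimately obtain vs where vs: "P vs" "\<And>ws. P ws \<Longrightarrow> length ws \<le> length vs"
    using ex_has_greatest_nat[of P "[x0]" length "Suc (card X)"] by blast
  define x where "x = vs ! 0"
  have ne: "vs \<noteq> []" "distinct vs" "set vs \<subseteq> X" using vs by (auto simp: P_def)
  have x: "x \<in> X" using ne by (auto simp: x_def)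
  have in_vs: "y \<in> set vs" if y: "y \<in> X" "R x y" for y
  proof (rule ccontr)
    assume "y \<notin> set vs"
    have "P (y # vs)"
      unfolding P_def
    proof (intro conjI allI impI)
      fix i assume "Suc i < length (y # vs)"
      then show "R ((y # vs) ! i) ((y # vs) ! Suc i)"
        using vs(1) sym[OF y(2)] by (cases i) (auto simp: P_def x_def)
    qed (use \<open>y \<notin> set vs\<close> y ne in auto)
    then show False using vs(2) by fastforce
  qed
  obtain y z where yz: "y \<in> X" "z \<in> X" "y \<noteq> z" "y \<noteq> x" "z \<noteq> x" "R x y" "R x z" using nb[OF x] by blast
  obtain i j where ij: "i < length vs" "y = vs ! i" "j < length vs" "z = vs ! j"
    using in_vs yz by (metis in_set_conv_nth)
  have "i \<noteq> j" "i \<noteq> 0" "j \<noteq> 0" using ij yz x_def by metis+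
  \<comment> \<open>The larger of two distinct nonzero positions is at least 2, so the closed cycle
    has at least three nodes.\<close>
  then have "\<exists>l. l < length vs \<and> 2 \<le> l \<and> R x (vs ! l)"
  proof (cases "i < j")
    case True
    then show ?thesis using ij yz \<open>i \<noteq> 0\<close> by (intro exI[of _ j]) auto
  next
    case False
    then show ?thesis using ij yz \<open>i \<noteq> j\<close> \<open>j \<noteq> 0\<close> by (intro exI[of _ i]) auto
  qed
  then obtain l where l: "l < length vs" "2 \<le> l" "R x (vs ! l)" by blast
  show thesis
  proof (rule that[of "take (Suc l) vs"])
    show "distinct (take (Suc l) vs)" "set (take (Suc l) vs) \<subseteq> X"
      using ne set_take_subset[of "Suc l" vs] by auto
    have len: "length (take (Suc l) vs) = Suc l" using l by simp
    then show "length (take (Suc l) vs) \<ge> 3" using l by simp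
    fix i assume "i < length (take (Suc l) vs)"
    then have i: "i \<le> l" using len by simp
    show "R (take (Suc l) vs ! i) (take (Suc l) vs ! (Suc i mod length (take (Suc l) vs)))"
    proof (cases "i = l")
      case True
      then show ?thesis using len l sym by (auto simp: x_def)
    next
      case False
      then have "Suc i mod Suc l = Suc i" using i by simp
      then show ?thesis using len vs(1) i l False by (simp add: P_def)
    qed
  qed
qed

lemma plane_graph_cycle_jordan:
  assumes D: "plane_graph D" and vs: "distinct vs" "length vs = k" "k \<ge> 3"
    and E: "\<And>i. i < k \<Longrightarrow> {vs ! i, vs ! (Suc i mod k)} \<in> edges D"
  shows "jordan_curve (\<Union>i<k. img D {vs ! i, vs ! (Suc i mod k)})"
proof -
  have eq: "vs ! i = vs ! j \<longleftrightarrow> i = j" if "i < k" "j < k" for i j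
    using that vs nth_eq_iff_index_eq by blast
  have E': "{vs ! i, vs ! Suc i} \<in> edges D" if "Suc i < k" for i
    using E[of i] that by simp
  have arc: "is_arc (\<Union>i<j. img D {vs ! i, vs ! Suc i}) (point D (vs ! 0)) (point D (vs ! j))"
    if "1 \<le> j" "j < k" for j
    using that
  proof (induction j rule: dec_induct)
    case base
    have "{..<1} = {0::nat}" by auto
    then show ?case using plane_graph_arc[OF D E'[of 0]] base by simp
  next
    case (step j)
    have e: "{vs ! j, vs ! Suc j} \<in> edges D" using E' step by simp
    have "(\<Union>i<j. img D {vs ! i, vs ! Suc i}) \<inter> img D {vs ! j, vs ! Suc j} \<subseteq> {point D (vs ! j)}"
    proof -
      have "img D {vs ! i, vs ! Suc i} \<inter> img D {vs ! j, vs ! Suc j} \<subseteq> {point D (vs ! j)}" if i: "i < j" for i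
      proof -
        have "vs ! i \<noteq> vs ! j" "vs ! i \<noteq> vs ! Suc j" "vs ! Suc i \<noteq> vs ! Suc j"
          using eq step i by auto
        then have ne: "{vs ! i, vs ! Suc i} \<noteq> {vs ! j, vs ! Suc j}"
          and int: "{vs ! i, vs ! Suc i} \<inter> {vs ! j, vs ! Suc j} \<subseteq> {vs ! j}" by (auto simp: doubleton_eq_iff)
        have "{vs ! i, vs ! Suc i} \<in> edges D" using E'[of i] i step by linarith
        from plane_graph_edges_disjoint[OF D this e ne] image_mono[OF int, of "point D"]
        show ?thesis unfolding image_insert image_empty by (rule subset_trans)
      qed
      then show ?thesis by blast
    qed
    then have "is_arc ((\<Union>i<j. img D {vs ! i, vs ! Suc i}) \<union> img D {vs ! j, vs ! Suc j})
        (point D (vs ! 0)) (point D (vs ! Suc j))"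
      using step plane_graph_arc[OF D e] by (intro is_arc_join) auto
    then show ?case by (simp add: lessThan_Suc Un_commute)
  qed
  define l where "l = k - 1"
  have l: "k = Suc l" "1 \<le> l" "2 \<le> l" using vs by (auto simp: l_def)
  have last: "{vs ! 0, vs ! l} \<in> edges D" using E[of l] l by (simp add: insert_commute)
  have "(\<Union>i<l. img D {vs ! i, vs ! Suc i}) \<inter> img D {vs ! 0, vs ! l} \<subseteq> {point D (vs ! 0), point D (vs ! l)}"
  proof -
    have "img D {vs ! i, vs ! Suc i} \<inter> img D {vs ! 0, vs ! l} \<subseteq> {point D (vs ! 0), point D (vs ! l)}"
      if i: "i < l" for i
    proof -
      \<comment> \<open>Here \<open>k \<ge> 3\<close> matters: for a cycle of length 2 the closing
        edge would be the first edge traversed backwards.\<close>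
      have "vs ! i \<noteq> vs ! l" "vs ! Suc i \<noteq> vs ! 0" "i = 0 \<Longrightarrow> vs ! Suc i \<noteq> vs ! l"
        using eq l i by auto
      moreover have "i \<noteq> 0 \<Longrightarrow> vs ! i \<noteq> vs ! 0" using eq l i by auto
      ultimately have ne: "{vs ! i, vs ! Suc i} \<noteq> {vs ! 0, vs ! l}" by (metis doubleton_eq_iff)
      have "{vs ! i, vs ! Suc i} \<in> edges D" using E'[of i] i l by linarith
      from plane_graph_edges_disjoint[OF D this last ne]
        image_mono[OF Int_lower2[of "{vs ! i, vs ! Suc i}" "{vs ! 0, vs ! l}"], of "point D"]
      show ?thesis unfolding image_insert image_empty by (rule subset_trans)
    qed
    then show ?thesis by blast
  qed
  then have "jordan_curve ((\<Union>i<l. img D {vs ! i, vs ! Suc i}) \<union> img D {vs ! 0, vs ! l})"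
    using arc[of l] l plane_graph_arc[OF D last] by (intro jordan_curveI) auto
  moreover have "(\<Union>i<k. img D {vs ! i, vs ! (Suc i mod k)}) =
      (\<Union>i<l. img D {vs ! i, vs ! Suc i}) \<union> img D {vs ! 0, vs ! l}"
  proof -
    have "(\<Union>i<l. img D {vs ! i, vs ! (Suc i mod k)}) = (\<Union>i<l. img D {vs ! i, vs ! Suc i})"
      by (rule SUP_cong) (use l in auto)
    then show ?thesis using l(1) by (simp add: lessThan_Suc insert_commute Un_commute)
  qed
  ultimately show ?thesis by simp
qed

section \<open>Midpoints and half edges\<close>

abbreviation mid :: "'a drawing \<Rightarrow> 'a set \<Rightarrow> complex" where
  "mid D e \<equiv> curve D e (1/2)"

text \<open>Edges are unordered, and the curve of an edge may start at either end; the test selects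
  the half that contains the end \<open>v\<close>.\<close>

definition half :: "'a drawing \<Rightarrow> 'a set \<Rightarrow> 'a \<Rightarrow> complex set" where
  "half D e v = (if pathstart (curve D e) = point D v then curve D e ` {0..1/2} else curve D e ` {1/2..1})"

lemma half_arcs:
  assumes D: "plane_graph D" and e: "{u, v} \<in> edges D"
  shows "is_arc (half D {u, v} u) (point D u) (mid D {u, v})"
    "half D {u, v} u \<union> half D {u, v} v = img D {u, v}"
    "half D {u, v} u \<inter> half D {u, v} v = {mid D {u, v}}"
proof -
  define g where "g = curve D {u, v}"
  have g: "arc g" "{pathstart g, pathfinish g} = {point D u, point D v}"
    using assms unfolding plane_graph_def g_def by (metis, metis image_empty image_insert)
  have ne: "point D u \<noteq> point D v" using plane_graph_point_eq[OF D] plane_graph_edge_ends[OF D e] by blast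
  have a1: "is_arc (g ` {0..1/2}) (pathstart g) (g (1/2))" "is_arc (g ` {1/2..1}) (g (1/2)) (pathfinish g)"
    using is_arc_subpath[OF g(1), of 0 "1/2"] is_arc_subpath[OF g(1), of "1/2" 1]
    by (auto simp: pathstart_def pathfinish_def)
  have "{0..1/2} \<union> {1/2..1} = {0..1::real}" by auto
  then have a2: "g ` {0..1/2} \<union> g ` {1/2..1} = path_image g" by (metis image_Un path_image_def)
  have "g ` {0..1/2} \<inter> g ` {1/2..1} = g ` ({0..1/2} \<inter> {1/2..1})"
    by (rule inj_on_image_Int[symmetric, of _ "{0..1}"]) (use g in \<open>auto simp: arc_def\<close>)
  also have "{0..1/2} \<inter> {1/2..1} = {1/2::real}" by auto
  finally have a3: "g ` {0..1/2} \<inter> g ` {1/2..1} = {g (1/2)}" by simp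
  from g(2) consider "pathstart g = point D u" "pathfinish g = point D v"
    | "pathstart g = point D v" "pathfinish g = point D u" by (metis doubleton_eq_iff)
  then show "is_arc (half D {u, v} u) (point D u) (mid D {u, v})"
    "half D {u, v} u \<union> half D {u, v} v = img D {u, v}"
    "half D {u, v} u \<inter> half D {u, v} v = {mid D {u, v}}"
    using a1 a2 a3 ne is_arc_sym[OF a1(2)]
    by (cases; simp add: half_def g_def[symmetric] Un_commute Int_commute)+
qed

lemma mid_not_vertex:
  assumes D: "plane_graph D" and e: "e \<in> edges D"
  shows "mid D e \<notin> point D ` vertices D" "mid D e \<in> img D e"
proof -
  obtain u v where uv: "e = {u, v}" using plane_graph_edgeE[OF D e] .
  note h = half_arcs[OF D, of u v] half_arcs[OF D, of v u]
  show m: "mid D e \<in> img D e" by (auto simp: path_image_def)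
  show "mid D e \<notin> point D ` vertices D"
  proof
    assume "mid D e \<in> point D ` vertices D"
    then obtain w where w: "w \<in> vertices D" "mid D e = point D w" by blast
    then have "w \<in> e" using plane_graph_on_edge[OF D e w(1)] m by simp
    then show False
      using is_arc_ends[OF h(1)] is_arc_ends[OF h(4)] e uv w by (auto simp: insert_commute)
  qed
qed

lemma mid_on_edge:
  assumes D: "plane_graph D" and e: "e \<in> edges D" "f \<in> edges D" "mid D e \<in> img D f"
  shows "e = f"
proof (rule ccontr)
  assume "e \<noteq> f"
  then have "mid D e \<in> point D ` (e \<inter> f)"
    using plane_graph_edges_disjoint[OF D e(1,2)] mid_not_vertex[OF D e(1)] e(3) by blast
  moreover have "e \<subseteq> vertices D" using plane_graph_edgeE[OF D e(1)] by blast
  ultimately show False using mid_not_vertex[OF D e(1)] by blast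
qed

lemma ball_avoiding_closed:
  fixes x :: complex
  assumes "closed K" "x \<notin> K"
  obtains e where "e > 0" "ball x e \<inter> K = {}"
  using assms by (metis ComplI disjoint_eq_subset_Compl open_Compl open_contains_ball)

lemma ball_avoiding_other_edges:
  assumes D: "plane_graph D" and e: "e \<in> edges D" and x: "x \<in> img D e" "x \<notin> point D ` vertices D"
  obtains r where "r > 0" "ball x r \<inter> drawn D \<subseteq> img D e - point D ` vertices D"
proof -
  define K where "K = point D ` vertices D \<union> (\<Union>f\<in>edges D - {e}. img D f)"
  have "closed K" unfolding K_def using closed_points[OF D] closed_edges[OF D] by (intro closed_Un) auto
  moreover have "x \<notin> K"
  proof
    assume "x \<in> K"
    then obtain f where f: "f \<in> edges D" "f \<noteq> e" "x \<in> img D f" using x unfolding K_def by blast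
    then have "x \<in> point D ` (f \<inter> e)" using plane_graph_edges_disjoint[OF D f(1) e f(2)] x by blast
    moreover have "e \<subseteq> vertices D" using plane_graph_edgeE[OF D e] by blast
    ultimately show False using x by blast
  qed
  ultimately obtain r where "r > 0" "ball x r \<inter> K = {}" using ball_avoiding_closed by blast
  then show thesis using that[of r] unfolding K_def drawn_def by blast
qed

section \<open>Faces at an edge and at a vertex of a triangulation\<close>

locale triangulated =
  fixes L :: "'a drawing"
  assumes tri: "planar_triangulation (vertices L) (edges L)"
    and large: "card (vertices L) \<ge> 3"
    and plane: "plane_graph L"
begin

abbreviation faces :: "complex set set" where
  "faces \<equiv> components (- drawn L)"

lemmas face_facts = component_facts[OF closed_drawn[OF plane]]

lemma face_with_edge:
  assumes T: "T \<in> faces" and e: "{u, w} \<in> boundary_edges L T"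
  obtains c where "{u, w} \<in> edges L" "{u, c} \<in> edges L" "{c, w} \<in> edges L"
    "frontier T = triangle L u c w" "T \<in> components (- triangle L u c w)"
    "boundary_edges L T = {{u, w}, {u, c}, {c, w}}"
proof -
  obtain x y z where E: "{x, y} \<in> edges L" "{y, z} \<in> edges L" "{x, z} \<in> edges L"
    "frontier T = triangle L x y z" "T \<in> components (- triangle L x y z)"
    using triangulation_face[OF tri large plane T] by metis
  have be: "boundary_edges L T = {{x, y}, {y, z}, {x, z}}"
  proof
    show "{{x, y}, {y, z}, {x, z}} \<subseteq> boundary_edges L T"
      using E by (auto simp: boundary_edges_def triangle_def)
    show "boundary_edges L T \<subseteq> {{x, y}, {y, z}, {x, z}}"
    proof
      fix f assume "f \<in> boundary_edges L T"
      then have f: "f \<in> edges L" "img L f \<subseteq> triangle L x y z" by (auto simp: boundary_edges_def E(4))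
      \<comment> \<open>A midpoint lies on no edge but its own, so an edge drawn inside the triangle
        is one of its three sides.\<close>
      have "mid L f \<in> img L {x, y} \<union> img L {y, z} \<union> img L {x, z}"
        using mid_not_vertex(2)[OF plane f(1)] f(2) by (auto simp: triangle_def)
      then show "f \<in> {{x, y}, {y, z}, {x, z}}" using mid_on_edge[OF plane f(1)] E by blast
    qed
  qed
  have p: "triangle L a b c = triangle L b a c" "triangle L a b c = triangle L a c b" for a b c
    by (auto simp: triangle_def insert_commute)
  have "x \<noteq> y" "y \<noteq> z" "x \<noteq> z" using plane_graph_edge_ends[OF plane] E by metis+
  from e be consider "u = x" "w = y" | "u = y" "w = x" | "u = y" "w = z" | "u = z" "w = y"
    | "u = x" "w = z" | "u = z" "w = x" by (auto simp: doubleton_eq_iff)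
  then show thesis
  proof cases
    case 1 then show thesis using that[of z] E be p by (auto simp: insert_commute)
  next
    case 2 then show thesis using that[of z] E be p by (auto simp: insert_commute)
  next
    case 3 then show thesis using that[of x] E be p by (auto simp: insert_commute)
  next
    case 4 then show thesis using that[of x] E be p by (auto simp: insert_commute)
  next
    case 5 then show thesis using that[of y] E be p by (auto simp: insert_commute)
  next
    case 6 then show thesis using that[of y] E be p by (auto simp: insert_commute)
  qed
qed

lemma faces_disjoint: "S \<in> faces \<Longrightarrow> T \<in> faces \<Longrightarrow> S \<noteq> T \<Longrightarrow> S \<inter> T = {}"
  using components_nonoverlap by blast

text \<open>A segment from a point of \<open>T\<close> to \<open>x\<close> leaves \<open>T\<close>
  within the ball. It does so at a non-vertex point of \<open>e\<close>, and one such frontier point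
  brings the whole edge with it.\<close>

lemma face_near_edge:
  assumes e: "e \<in> edges L" and x: "x \<in> img L e"
    and r: "ball x r \<inter> drawn L \<subseteq> img L e - point L ` vertices L"
    and T: "T \<in> faces" "T \<inter> ball x r \<noteq> {}"
  shows "e \<in> boundary_edges L T"
proof -
  obtain p where p: "p \<in> T" "p \<in> ball x r" using T by blast
  then have "r > 0" by (metis ball_eq_empty empty_iff not_le)
  have xT: "x \<notin> T" using face_facts(4)[OF T(1)] x e by (auto simp: drawn_def)
  have "closed_segment p x \<inter> frontier T \<noteq> {}"
    by (rule connected_Int_frontier) (use p xT in auto)
  then obtain y where y: "y \<in> closed_segment p x" "y \<in> frontier T" by blast
  have "closed_segment p x \<subseteq> ball x r" using p \<open>r > 0\<close> by (intro closed_segment_subset) auto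
  then have "y \<in> img L e" "y \<notin> point L ` vertices L" using y r face_facts(5)[OF T(1)] by blast+
  then have "img L e \<subseteq> frontier T" using edge_in_frontier[OF plane T(1) e] y by blast
  then show ?thesis using e by (simp add: boundary_edges_def)
qed

text \<open>The last conclusion is what turns two into exactly two: no third face comes near an
  interior point of the edge.\<close>

lemma edge_two_faces:
  assumes e: "e \<in> edges L"
  obtains S T where "S \<in> faces" "T \<in> faces" "S \<noteq> T" "e \<in> boundary_edges L S" "e \<in> boundary_edges L T"
    "\<And>x. x \<in> img L e \<Longrightarrow> x \<notin> point L ` vertices L \<Longrightarrow> \<exists>r>0. ball x r \<subseteq> S \<union> T \<union> img L e"
proof -
  obtain u w where uw: "e = {u, w}" "u \<in> vertices L" "w \<in> vertices L" using plane_graph_edgeE[OF plane e] .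
  define z where "z = mid L e"
  have z: "z \<in> img L e" "z \<notin> point L ` vertices L" using mid_not_vertex[OF plane e] by (auto simp: z_def)
  obtain r where r: "r > 0" "ball z r \<inter> drawn L \<subseteq> img L e - point L ` vertices L"
    using ball_avoiding_other_edges[OF plane e z] .
  have arc: "is_arc (img L e) (point L u) (point L w)" using plane_graph_arc[OF plane] e uw by blast
  \<comment> \<open>An arc has empty interior, so there is a point near the midpoint off the edge
    and, within this ball, off the whole drawing.\<close>
  have "\<not> ball z r \<subseteq> img L e"
    using is_arc_interior[OF arc] r(1) by (metis centre_in_ball empty_iff interior_maximal open_ball subset_eq)
  then obtain p where p: "p \<in> ball z r" "p \<notin> drawn L" using r(2) by blast
  then obtain S where S: "S \<in> faces" "p \<in> S" using Union_components[of "- drawn L"] by blast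
  have eS: "e \<in> boundary_edges L S" using face_near_edge[OF e z(1) r(2) S(1)] S p by blast
  obtain c where c: "{u, w} \<in> edges L" "{u, c} \<in> edges L" "{c, w} \<in> edges L"
    "frontier S = triangle L u c w" "S \<in> components (- triangle L u c w)"
    using face_with_edge[OF S(1)] eS uw(1) by metis
  define C where "C = triangle L u c w"
  have JC: "jordan_curve C" unfolding C_def using triangle_jordan[OF plane c(2,3,1)] .
  have SC: "S \<in> components (- C)" using c by (simp add: C_def)
  have eC: "img L e \<subseteq> C" unfolding C_def triangle_def uw by blast
  note SS = jordan_component_facts[OF JC SC]
  obtain G S' where GS': "G \<in> components (- C)" "S' \<in> components (- C)" "G \<noteq> S'" "G \<union> S' = - C" "S \<subseteq> S'"
    using jordan_other_component[OF JC SS(5,3,4)] by metis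
  have "S' = S" using components_eq[OF GS'(2) SC] GS'(5) SS(4) by blast
  then have G: "G \<in> components (- C)" "G \<noteq> S" "S \<union> G = - C" using GS' by auto
  have GS: "G \<inter> S = {}" using components_nonoverlap[OF G(1) SC] G(2) by blast
  \<comment> \<open>The second face is found from a point on the far side \<open>G\<close> of the
    triangle around \<open>S\<close>; since \<open>G\<close> and \<open>S\<close> are disjoint, it
    differs from \<open>S\<close>.\<close>
  have "z \<in> closure G" using jordan_component_facts(6)[OF JC G(1)] eC z by blast
  then obtain q where q: "q \<in> G" "q \<in> ball z r"
    using r(1) by (metis closure_approachable dist_commute mem_ball)
  then have "q \<notin> drawn L" using r(2) eC G in_components_subset by blast
  then obtain T where T: "T \<in> faces" "q \<in> T" using Union_components[of "- drawn L"] by blast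
  have eT: "e \<in> boundary_edges L T" using face_near_edge[OF e z(1) r(2) T(1)] T q by blast
  have ST: "S \<noteq> T" using q T GS by blast
  obtain d where d: "{u, d} \<in> edges L" "{d, w} \<in> edges L"
    "frontier T = triangle L u d w" "T \<in> components (- triangle L u d w)"
    using face_with_edge[OF T(1)] eT uw(1) by metis
  have near: "\<exists>s>0. ball x s \<subseteq> S \<union> T \<union> img L e" if x: "x \<in> img L e" "x \<notin> point L ` vertices L" for x
  proof -
    obtain s where s: "s > 0" "ball x s \<inter> drawn L \<subseteq> img L e - point L ` vertices L"
      using ball_avoiding_other_edges[OF plane e x] .
    have "p \<in> S \<union> T" if p: "p \<in> ball x s" "p \<notin> img L e" for p
    proof (cases "c = d")
      \<comment> \<open>Both faces have the same triangle \<open>C\<close> as frontier. Then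
        \<open>T\<close> is the other side of \<open>C\<close>, and \<open>S\<close>,
        \<open>T\<close> and \<open>C\<close> cover the plane.\<close>
      case True
      then have "T \<in> components (- C)" using d by (simp add: C_def)
      then have "T = G" using q T components_eq[OF _ G(1)] by blast
      moreover have "C \<subseteq> drawn L" using c unfolding C_def triangle_def drawn_def by blast
      then have "p \<notin> C" using p s by blast
      ultimately show ?thesis using G(3) by blast
    next
      case False
      have dist: "u \<noteq> w" "u \<noteq> c" "c \<noteq> w" "u \<noteq> d" "d \<noteq> w" using plane_graph_edge_ends[OF plane] c d by metis+
      define P where "P = img L {u, c} \<union> img L {c, w}"
      define Q where "Q = img L {u, d} \<union> img L {d, w}"
      have P: "is_arc P (point L u) (point L w)" unfolding P_def using plane_graph_path2[OF plane] c dist by blast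
      have Q: "is_arc Q (point L u) (point L w)" unfolding Q_def using plane_graph_path2[OF plane] d dist by blast
      have int: "img L a \<inter> img L b \<subseteq> {point L u, point L w}"
        if "a \<in> edges L" "b \<in> edges L" "a \<noteq> b" "a \<inter> b \<subseteq> {u, w}" for a b
        using plane_graph_edges_disjoint[OF plane that(1-3)] that(4) by auto
      \<comment> \<open>The edge and the remaining two sides of either triangle form a theta curve.
        \<open>S\<close> is a side that avoids \<open>Q\<close>, \<open>T\<close> one that avoids
        \<open>P\<close>, and \<open>theta_two_sided\<close> leaves nothing else near
        \<open>x\<close>.\<close>
      have th: "theta (img L e) P Q (point L u) (point L w)"
        unfolding theta_def
      proof (intro conjI arc P Q subset_antisym)
        show "img L e \<inter> P \<subseteq> {point L u, point L w}"
          using int[OF e c(2)] int[OF e c(3)] dist unfolding uw P_def by (auto simp: doubleton_eq_iff)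
        show "img L e \<inter> Q \<subseteq> {point L u, point L w}"
          using int[OF e d(1)] int[OF e d(2)] dist unfolding uw Q_def by (auto simp: doubleton_eq_iff)
        show "P \<inter> Q \<subseteq> {point L u, point L w}"
          using int[OF c(2) d(1)] int[OF c(2) d(2)] int[OF c(3) d(1)] int[OF c(3) d(2)] dist False
          unfolding P_def Q_def by (auto simp: doubleton_eq_iff)
      qed (use is_arc_ends[OF arc] is_arc_ends[OF P] is_arc_ends[OF Q] in auto)
      have PQ: "P \<subseteq> drawn L" "Q \<subseteq> drawn L" using c d unfolding P_def Q_def drawn_def by blast+
      have "S \<in> components (- (img L e \<union> P))" "T \<in> components (- (img L e \<union> Q))"
        using c(5) d(4) by (simp_all add: triangle_def P_def Q_def uw Un_ac)
      moreover have "S \<inter> Q = {}" "T \<inter> P = {}"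
        using face_facts(4)[OF S(1)] face_facts(4)[OF T(1)] PQ by blast+
      moreover have "ball x s \<inter> (P \<union> Q) = {}"
      proof -
        have "(P \<union> Q) \<inter> img L e \<subseteq> {point L u, point L w}" using th by (auto simp: theta_def)
        then show ?thesis using s(2) PQ uw by blast
      qed
      ultimately show ?thesis using theta_two_sided[OF th] x(1) p by blast
    qed
    then show ?thesis using s(1) by blast
  qed
  show thesis using that[OF S(1) T(1) ST eS eT near] .
qed

text \<open>Every face with \<open>e\<close> on its boundary has points near \<open>x\<close> and so
  is one of the two faces supplied by \<open>edge_two_faces\<close>; two distinct ones are therefore
  exactly those two.\<close>

lemma edge_two_sided:
  assumes e: "e \<in> edges L" and T: "T1 \<in> faces" "T2 \<in> faces" "T1 \<noteq> T2"
    "e \<in> boundary_edges L T1" "e \<in> boundary_edges L T2"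
    and x: "x \<in> img L e" "x \<notin> point L ` vertices L"
  shows "\<exists>r>0. ball x r \<subseteq> T1 \<union> T2 \<union> img L e"
proof -
  obtain S S' where S: "S \<in> faces" "S' \<in> faces"
    and near: "\<And>x. x \<in> img L e \<Longrightarrow> x \<notin> point L ` vertices L \<Longrightarrow> \<exists>r>0. ball x r \<subseteq> S \<union> S' \<union> img L e"
    using edge_two_faces[OF e] by metis
  obtain r where r: "r > 0" "ball x r \<subseteq> S \<union> S' \<union> img L e" using near[OF x] by blast
  have "U = S \<or> U = S'" if U: "U \<in> faces" "e \<in> boundary_edges L U" for U
  proof -
    have "x \<in> closure U" using x U(2) by (auto simp: boundary_edges_def frontier_def)
    then obtain p where p: "p \<in> U" "p \<in> ball x r"
      using r(1) by (metis closure_approachable dist_commute mem_ball)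
    then have "p \<notin> img L e" using face_facts(4)[OF U(1)] e by (auto simp: drawn_def)
    then show ?thesis using p r faces_disjoint S U(1) by blast
  qed
  then have "{S, S'} = {T1, T2}" using T by blast
  then have "S \<union> S' = T1 \<union> T2" by blast
  then show ?thesis using near[OF x] by simp
qed

text \<open>Around an isolated vertex a punctured disc lies in one face. The vertex is then on the
  frontier of that face, and this frontier is a triangle, made up of edges.\<close>

lemma vertex_on_edge:
  assumes v: "v \<in> vertices L"
  obtains e where "e \<in> edges L" "v \<in> e"
proof (rule ccontr)
  assume "\<not> thesis"
  then have iso: "v \<notin> e" if "e \<in> edges L" for e using that \<open>\<not> thesis\<close> \<open>\<And>e. \<lbrakk>e \<in> edges L; v \<in> e\<rbrakk> \<Longrightarrow> thesis\<close> by blast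
  define K where "K = point L ` (vertices L - {v}) \<union> (\<Union>e\<in>edges L. img L e)"
  have "closed K" unfolding K_def using closed_points[OF plane] closed_edges[OF plane] by (intro closed_Un) auto
  moreover have "point L v \<notin> K"
    using plane_graph_on_edge[OF plane _ v] plane_graph_point_eq[OF plane] v iso unfolding K_def by auto
  ultimately obtain r where r: "r > 0" "ball (point L v) r \<inter> K = {}" using ball_avoiding_closed by blast
  define B where "B = ball (point L v) r - {point L v}"
  have "drawn L = insert (point L v) K" unfolding drawn_def K_def using v by blast
  then have "B \<subseteq> - drawn L" using r by (auto simp: B_def)
  moreover have "connected B" unfolding B_def by (intro connected_punctured_ball) simp
  moreover have "point L v islimpt ball (point L v) r" using r(1) by (simp add: islimpt_ball)
  then have vB: "point L v \<in> closure B" unfolding B_def by (meson islimpt_in_closure)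
  then have "B \<noteq> {}" by auto
  ultimately obtain T where T: "T \<in> faces" "B \<subseteq> T"
    using exists_component_superset[of B "- drawn L"] by blast
  have "point L v \<in> closure T" using vB T(2) closure_mono by blast
  then have "point L v \<in> frontier T"
    using face_facts(1,4)[OF T(1)] v by (auto simp: frontier_def drawn_def interior_open)
  moreover obtain a b c where E: "{a, b} \<in> edges L" "{b, c} \<in> edges L" "{a, c} \<in> edges L"
    "frontier T = triangle L a b c"
    using triangulation_face[OF tri large plane T(1)] by metis
  ultimately have "\<exists>e\<in>edges L. point L v \<in> img L e" by (auto simp: triangle_def)
  then show False using iso plane_graph_on_edge[OF plane _ v] by blast
qed

end

section \<open>The conjugated triangulation\<close>

locale conjugated = triangulated L for L :: "'a drawing" +
  fixes H :: "'a set drawing"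
  assumes conj: "conjugated_triangulation L H"
begin

lemma bounded_faces_L: "bounded_faces L = {T \<in> faces. bounded T}"
  by (simp add: bounded_faces_def drawn_def)

lemma bounded_faces_H: "bounded_faces H = {F \<in> components (- drawn H). bounded F}"
  by (simp add: bounded_faces_def drawn_def)

lemma plane_H: "plane_graph H"
  and vertices_H: "vertices H = edges L"
  and edges_H: "edges H = (\<Union>T\<in>bounded_faces L. medians L T)"
  using conj by (auto simp: conjugated_triangulation_def)

lemma point_H: "e \<in> edges L \<Longrightarrow> point H e = mid L e"
  using conj by (auto simp: conjugated_triangulation_def)

lemmas face_facts_H = component_facts[OF closed_drawn[OF plane_H]]

lemma face_disjoint_drawn: "T \<in> faces \<Longrightarrow> T \<inter> drawn L = {}"
  using face_facts(4) .

lemma median: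
  assumes T: "T \<in> bounded_faces L" and ef: "e \<in> boundary_edges L T" "f \<in> boundary_edges L T" "e \<noteq> f"
  shows "{e, f} \<in> medians L T" "{e, f} \<in> edges H" "is_arc (img H {e, f}) (mid L e) (mid L f)"
    "img H {e, f} - {mid L e, mid L f} \<subseteq> T"
proof -
  show m: "{e, f} \<in> medians L T" using ef unfolding medians_def by blast
  then show E: "{e, f} \<in> edges H" using T edges_H by blast
  have "e \<in> edges L" "f \<in> edges L" using ef by (auto simp: boundary_edges_def)
  then have p: "point H e = mid L e" "point H f = mid L f" using point_H by auto
  show "is_arc (img H {e, f}) (mid L e) (mid L f)" using plane_graph_arc[OF plane_H E] p by simp
  have "\<forall>T\<in>bounded_faces L. \<forall>m\<in>medians L T. img H m - point H ` m \<subseteq> T"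
    using conj by (simp add: conjugated_triangulation_def)
  then have "img H {e, f} - point H ` {e, f} \<subseteq> T" using T m by blast
  then show "img H {e, f} - {mid L e, mid L f} \<subseteq> T" by (simp add: p)
qed

lemma edge_H_E:
  assumes "m \<in> edges H"
  obtains T e f where "T \<in> bounded_faces L" "m = {e, f}" "e \<in> boundary_edges L T" "f \<in> boundary_edges L T" "e \<noteq> f"
  using assms unfolding edges_H medians_def by blast

lemma drawn_H_E:
  assumes "x \<in> drawn H"
  obtains e where "e \<in> edges L" "x = mid L e"
  | T e f where "T \<in> bounded_faces L" "e \<in> boundary_edges L T" "f \<in> boundary_edges L T" "e \<noteq> f"
    "x \<in> img H {e, f}" "x \<in> T"
proof -
  from assms consider e where "e \<in> edges L" "x = point H e" | m where "m \<in> edges H" "x \<in> img H m"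
    unfolding drawn_def vertices_H by blast
  then show thesis
  proof cases
    case 1 then show thesis using that(1) point_H by blast
  next
    case 2
    obtain T e f where T: "T \<in> bounded_faces L" "m = {e, f}" "e \<in> boundary_edges L T" "f \<in> boundary_edges L T" "e \<noteq> f"
      using edge_H_E[OF 2(1)] .
    have "e \<in> edges L" "f \<in> edges L" using T by (auto simp: boundary_edges_def)
    show thesis
    proof (cases "x \<in> {mid L e, mid L f}")
      case True then show thesis using that(1) \<open>e \<in> edges L\<close> \<open>f \<in> edges L\<close> by blast
    next
      case False
      then have "x \<in> T" using median(4)[OF T(1,3,4,5)] 2(2) T(2) by blast
      then show thesis using that(2) T 2(2) by blast
    qed
  qed
qed

lemma drawn_H_Int_drawn_L:
  assumes "x \<in> drawn H" "x \<in> drawn L"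
  obtains e where "e \<in> edges L" "x = mid L e"
  using assms(1)
proof (cases rule: drawn_H_E)
  case (1 e) then show thesis using that by blast
next
  case (2 T e f)
  then show thesis using assms(2) face_disjoint_drawn by (auto simp: bounded_faces_L)
qed

text \<open>The first conclusion has a use of its own: an unbounded face of \<open>L\<close>
  contains no point of the drawing of \<open>H\<close>, so a face of \<open>H\<close> that meets it
  contains it.\<close>

lemma drawn_H_in_face:
  assumes T: "T \<in> faces" and x: "x \<in> drawn H" "x \<in> T"
  obtains e f where "T \<in> bounded_faces L" "e \<in> boundary_edges L T" "f \<in> boundary_edges L T" "e \<noteq> f"
    "x \<in> img H {e, f}"
  using x(1)
proof (cases rule: drawn_H_E)
  case (1 e)
  then have "x \<in> drawn L" using mid_not_vertex[OF plane] by (auto simp: drawn_def)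
  then show thesis using face_disjoint_drawn[OF T] x by blast
next
  case (2 S e f)
  then have "S = T" using faces_disjoint[of S T] T x by (auto simp: bounded_faces_L)
  then show thesis using that 2 by blast
qed

lemma mid_in_drawn_H: "e \<in> edges L \<Longrightarrow> mid L e \<in> drawn H"
  using point_H[of e] by (auto simp: drawn_def vertices_H intro: image_eqI[of _ _ e])

section \<open>Corners cut off by a median\<close>

lemma half_disjoint_drawn_H:
  assumes e: "{u, v} \<in> edges L"
  shows "half L {u, v} u \<inter> drawn H = {mid L {u, v}}"
proof -
  note h = half_arcs[OF plane e]
  have "x = mid L {u, v}" if x: "x \<in> half L {u, v} u" "x \<in> drawn H" for x
  proof -
    have "x \<in> img L {u, v}" using x h by blast
    moreover from this have "x \<in> drawn L" using e by (auto simp: drawn_def)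
    ultimately show ?thesis
      using drawn_H_Int_drawn_L[OF x(2)] mid_on_edge[OF plane _ e] by metis
  qed
  then show ?thesis using is_arc_ends[OF h(1)] mid_in_drawn_H[OF e] by blast
qed

text \<open>The midpoints split the frontier of \<open>T\<close> into the path \<open>P\<close>
  through \<open>v\<close> and the rest \<open>P'\<close>. With the median these form a theta curve,
  and the corner is the side of \<open>P \<union> M\<close> away from \<open>P'\<close>. The last
  conclusion, that \<open>T\<close> has no other points near the two half edges, later makes the
  union of the corners open.\<close>

lemma corner:
  assumes T: "T \<in> bounded_faces L"
    and ef: "{v, a} \<in> boundary_edges L T" "{v, b} \<in> boundary_edges L T" "a \<noteq> b"
  defines "e \<equiv> {v, a}" and "f \<equiv> {v, b}"
  obtains Q where "open Q" "connected Q" "Q \<subseteq> T" "Q \<inter> drawn H = {}"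
    "closure Q = Q \<union> (half L e v \<union> half L f v \<union> img H {e, f})"
    "\<And>x. x \<in> half L e v \<union> half L f v - {mid L e, mid L f} \<Longrightarrow> \<exists>r>0. ball x r \<inter> T \<subseteq> Q"
proof -
  have TF: "T \<in> faces" using T by (simp add: bounded_faces_L)
  obtain c where c: "{v, a} \<in> edges L" "{v, c} \<in> edges L" "{c, a} \<in> edges L"
    "frontier T = triangle L v c a" "T \<in> components (- triangle L v c a)"
    "boundary_edges L T = {{v, a}, {v, c}, {c, a}}"
    using face_with_edge[OF TF ef(1)] .
  have dist0: "v \<noteq> a" "v \<noteq> c" "c \<noteq> a" using plane_graph_edge_ends[OF plane] c by metis+
  have "b = c" using ef(2) c(6) ef(3) dist0 by (auto simp: doubleton_eq_iff)
  note c = c[unfolded \<open>b = c\<close>[symmetric]] and dist = dist0[unfolded \<open>b = c\<close>[symmetric]]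
  define g where "g = {b, a}"
  have E: "e \<in> edges L" "f \<in> edges L" "g \<in> edges L" using c by (auto simp: e_def f_def g_def)
  have neq: "e \<noteq> f" "e \<noteq> g" "f \<noteq> g" using dist by (auto simp: e_def f_def g_def doubleton_eq_iff)
  have be: "boundary_edges L T = {e, f, g}" using c(6) by (simp add: e_def f_def g_def)
  have he: "is_arc (half L e v) (point L v) (mid L e)" "is_arc (half L e a) (point L a) (mid L e)"
    "half L e v \<union> half L e a = img L e" "half L e v \<inter> half L e a = {mid L e}"
    using half_arcs[OF plane, of v a] half_arcs[OF plane, of a v] c(1)
    unfolding e_def by (simp_all add: insert_commute)
  have hf: "is_arc (half L f v) (point L v) (mid L f)" "is_arc (half L f b) (point L b) (mid L f)"
    "half L f v \<union> half L f b = img L f" "half L f v \<inter> half L f b = {mid L f}"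
    using half_arcs[OF plane, of v b] half_arcs[OF plane, of b v] c(2)
    unfolding f_def by (simp_all add: insert_commute)
  have ag: "is_arc (img L g) (point L a) (point L b)"
    using plane_graph_arc[OF plane, of a b] c(3) by (simp add: g_def insert_commute)
  have iefs: "img L e \<inter> img L f \<subseteq> {point L v}" "img L e \<inter> img L g \<subseteq> {point L a}" "img L f \<inter> img L g \<subseteq> {point L b}"
    using plane_graph_edges_disjoint[OF plane E(1,2) neq(1)] plane_graph_edges_disjoint[OF plane E(1,3) neq(2)]
      plane_graph_edges_disjoint[OF plane E(2,3) neq(3)] dist
    by (auto simp: e_def f_def g_def)
  have nv: "mid L e \<notin> point L ` vertices L" "mid L f \<notin> point L ` vertices L" "mid L g \<notin> point L ` vertices L"
    "mid L g \<in> img L g"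
    using mid_not_vertex[OF plane] E by blast+
  have V: "v \<in> vertices L" "a \<in> vertices L" "b \<in> vertices L"
    using plane_graph_edge_ends[OF plane c(1)] plane_graph_edge_ends[OF plane c(2)] by auto
  have av: "point L a \<notin> half L e v" "point L b \<notin> half L f v" "point L v \<notin> half L e a" "point L v \<notin> half L f b"
    using is_arc_ends[OF he(1)] is_arc_ends[OF he(2)] is_arc_ends[OF hf(1)] is_arc_ends[OF hf(2)] he(4) hf(4) nv V
    by auto
  define P where "P = half L e v \<union> half L f v"
  define P' where "P' = half L e a \<union> (img L g \<union> half L f b)"
  define M where "M = img H {e, f}"
  have TM: "e \<in> boundary_edges L T" "f \<in> boundary_edges L T" "g \<in> boundary_edges L T" using be by auto
  note med = median[OF T TM(1,2) neq(1), folded M_def]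
  have Parc: "is_arc P (mid L e) (mid L f)"
    unfolding P_def using is_arc_join[OF is_arc_sym[OF he(1)] hf(1)] iefs(1) he(3) hf(3) by blast
  have "is_arc (img L g \<union> half L f b) (point L a) (mid L f)"
    using is_arc_join[OF ag hf(2)] iefs(3) hf(3) by blast
  moreover have "half L e a \<inter> (img L g \<union> half L f b) \<subseteq> {point L a}"
    using iefs(1,2) he(3) hf(3) av by blast
  ultimately have P'arc: "is_arc P' (mid L e) (mid L f)"
    unfolding P'_def using is_arc_join[OF is_arc_sym[OF he(2)]] by blast
  have Pg: "P \<inter> img L g = {}" using iefs av he(3) hf(3) unfolding P_def by blast
  have PP': "P \<union> P' = frontier T"
    unfolding c(4) P_def P'_def triangle_def using he(3) hf(3) by (auto simp: e_def f_def g_def)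
  have "half L e v \<inter> half L f b = {}" "half L f v \<inter> half L e a = {}"
    using iefs(1) he(3) hf(3) av by blast+
  then have PiP': "P \<inter> P' = {mid L e, mid L f}"
    using he(4) hf(4) Pg unfolding P_def P'_def by blast
  have Tfr: "T \<inter> frontier T = {}" using face_facts(1)[OF TF] by (simp add: frontier_def interior_open)
  have ends: "mid L e \<in> P" "mid L f \<in> P" "mid L e \<in> P'" "mid L f \<in> P'" "mid L e \<in> M" "mid L f \<in> M"
    using is_arc_ends[OF Parc] is_arc_ends[OF P'arc] is_arc_ends[OF med(3)] by auto
  have PM: "P \<inter> M = {mid L e, mid L f}" "P' \<inter> M = {mid L e, mid L f}"
    using med(4) Tfr PP' ends by blast+
  have th: "theta P P' M (mid L e) (mid L f)"
    unfolding theta_def using Parc P'arc med(3) PiP' PM by blast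
  have TC: "T \<in> components (- (P \<union> P'))" using c(4,5) PP' by simp
  \<comment> \<open>\<open>S\<close> is the side of the frontier of \<open>T\<close> that is not
    \<open>T\<close>, because \<open>T\<close> contains the open median.\<close>
  obtain S where S: "S \<in> components (- (P \<union> P'))" "S \<inter> M = {}" using theta_far_side[OF th] .
  have inM: "M - {mid L e, mid L f} \<noteq> {}" using is_arc_open_connected(2)[OF med(3)] .
  have ST: "S \<inter> T = {}"
  proof -
    have "S \<noteq> T" using S(2) med(4) inM by blast
    then show ?thesis using components_nonoverlap[OF S(1) TC] by blast
  qed
  obtain Q where Q: "Q \<in> components (- (P \<union> M))" "Q \<inter> P' = {}"
    using theta_far_side[OF theta_perm(2)[OF th]] .
  have JQ: "jordan_curve (P \<union> M)" using theta_jordan[OF theta_perm(2)[OF th]] .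
  note QQ = jordan_component_facts[OF JQ Q(1)]
  \<comment> \<open>The open median lies in \<open>T\<close> and on the frontier of
    \<open>Q\<close>, so the two sets meet; since \<open>Q\<close> also avoids \<open>P'\<close>, it
    cannot leave \<open>T\<close>.\<close>
  have QT: "Q \<subseteq> T"
  proof -
    obtain y where y: "y \<in> M" "y \<in> T" using inM med(4) by blast
    then have "y \<in> closure Q" using QQ(6) by blast
    then have "Q \<inter> T \<noteq> {}"
      using y(2) face_facts(1)[OF TF] by (metis Int_commute open_Int_closure_eq_empty IntI empty_iff)
    moreover have "Q \<subseteq> - (P \<union> P')" using Q(2) QQ(5) by blast
    ultimately show ?thesis using components_maximal[OF TC QQ(3)] by blast
  qed
  have QH: "Q \<inter> drawn H = {}"
  proof (rule ccontr)
    assume "Q \<inter> drawn H \<noteq> {}"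
    then obtain x where x: "x \<in> Q" "x \<in> drawn H" by blast
    obtain e' f' where "T \<in> bounded_faces L" and
      ef': "e' \<in> boundary_edges L T" "f' \<in> boundary_edges L T" "e' \<noteq> f'" "x \<in> img H {e', f'}"
      using drawn_H_in_face[OF TF x(2) subsetD[OF QT x(1)]] .
    \<comment> \<open>Without its end on \<open>P\<close>, another median is connected and avoids
      \<open>P \<union> M\<close>. Meeting \<open>Q\<close> it would lie in \<open>Q\<close>
      altogether, although its other end is on \<open>P'\<close>.\<close>
    have contra: False if h: "h = e \<or> h = f" and xh: "x \<in> img H {h, g}" for h
    proof -
      have hb: "h \<in> boundary_edges L T" "h \<noteq> g" using h be neq by auto
      note m = median[OF T hb(1) TM(3) hb(2)]
      have hP: "mid L h \<in> P" using h ends by blast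
      have con: "connected (img H {h, g} - {mid L h})" using is_arc_delete_end[OF m(3)] .
      have "(img H {h, g} - {mid L h}) \<inter> P = {}"
        using m(4) Tfr PP' Pg nv(4) by blast
      moreover have "img H {h, g} \<inter> M \<subseteq> {mid L h}"
      proof -
        have "{h, g} \<noteq> {e, f}" "{h, g} \<inter> {e, f} = {h}" using h neq by (auto simp: doubleton_eq_iff)
        then have "img H {h, g} \<inter> M \<subseteq> {point H h}"
          using plane_graph_edges_disjoint[OF plane_H m(2) med(2)] unfolding M_def by auto
        then show ?thesis using point_H[of h] h E by auto
      qed
      ultimately have "img H {h, g} - {mid L h} \<subseteq> - (P \<union> M)" by blast
      moreover have "x \<in> img H {h, g} - {mid L h}" using xh x(1) QQ(5) hP by blast
      ultimately have "img H {h, g} - {mid L h} \<subseteq> Q" using components_maximal[OF Q(1) con] x(1) by blast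
      moreover have "mid L g \<in> img H {h, g} - {mid L h}" using is_arc_ends[OF m(3)] by auto
      moreover have "mid L g \<in> P'" using nv(4) by (simp add: P'_def)
      ultimately show False using Q(2) by blast
    qed
    have "{e', f'} = {e, f} \<or> {e', f'} = {e, g} \<or> {e', f'} = {f, g}"
      using ef'(1-3) unfolding be by (elim insertE emptyE) (simp_all add: insert_commute)
    then show False using contra[of e] contra[of f] ef'(4) x(1) QQ(5) unfolding M_def by auto
  qed
  have near: "\<exists>r>0. ball x r \<inter> T \<subseteq> Q" if x: "x \<in> half L e v \<union> half L f v - {mid L e, mid L f}" for x
  proof -
    have xP: "x \<in> P" using x by (simp add: P_def)
    have "closed (P' \<union> M)" using is_arc_closed[OF P'arc] is_arc_closed[OF med(3)] by blast
    moreover have "x \<notin> P' \<union> M" using x xP PiP' PM by blast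
    ultimately obtain r where r: "r > 0" "ball x r \<inter> (P' \<union> M) = {}" using ball_avoiding_closed by blast
    \<comment> \<open>Near \<open>x\<close> the theta curve leaves only the sides \<open>S\<close>
      and \<open>Q\<close>, and \<open>S\<close> is disjoint from \<open>T\<close>.\<close>
    have "p \<in> Q" if p: "p \<in> ball x r" "p \<in> T" for p
    proof -
      have "p \<notin> P" using p(2) Tfr PP' by blast
      then have "p \<in> S \<union> Q" using theta_two_sided[OF th S Q xP r(2) p(1)] by blast
      then show ?thesis using ST p(2) by blast
    qed
    then show ?thesis using r(1) by blast
  qed
  have "closure Q = Q \<union> (half L e v \<union> half L f v \<union> img H {e, f})"
    using QQ(6) by (simp add: P_def M_def)
  then show thesis using that[OF QQ(2,3) QT QH _ near] by blast
qed

section \<open>Faces bounded by the medians of one face\<close>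

lemma median_cycle:
  assumes T: "T \<in> bounded_faces L"
  obtains e f g where "boundary_edges L T = {e, f, g}" "e \<noteq> f" "f \<noteq> g" "e \<noteq> g"
    "medians L T = {{e, f}, {f, g}, {g, e}}"
proof -
  have TF: "T \<in> faces" using T by (simp add: bounded_faces_L)
  obtain a b c where abc: "{a, b} \<in> edges L" "{b, c} \<in> edges L" "{a, c} \<in> edges L" "frontier T = triangle L a b c"
    using triangulation_face[OF tri large plane TF] by metis
  then have "{a, b} \<in> boundary_edges L T" by (auto simp: boundary_edges_def triangle_def)
  then obtain d where d: "boundary_edges L T = {{a, b}, {a, d}, {d, b}}"
     "{a, b} \<in> edges L" "{a, d} \<in> edges L" "{d, b} \<in> edges L"
    using face_with_edge[OF TF] by metis
  have "a \<noteq> b" "a \<noteq> d" "d \<noteq> b" using plane_graph_edge_ends[OF plane] d by metis+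
  then have ne: "{a, b} \<noteq> {a, d}" "{a, d} \<noteq> {d, b}" "{a, b} \<noteq> {d, b}" by (auto simp: doubleton_eq_iff)
  have pairs: "{{x, y} | x y. x \<in> {e, f, g} \<and> y \<in> {e, f, g} \<and> x \<noteq> y} = {{e, f}, {f, g}, {g, e}}"
    if "e \<noteq> f" "f \<noteq> g" "e \<noteq> g" for e f g :: "'a set"
  proof (intro equalityI subsetI)
    fix m assume "m \<in> {{x, y} | x y. x \<in> {e, f, g} \<and> y \<in> {e, f, g} \<and> x \<noteq> y}"
    then obtain x y where "m = {x, y}" "x \<in> {e, f, g}" "y \<in> {e, f, g}" "x \<noteq> y" by blast
    then show "m \<in> {{e, f}, {f, g}, {g, e}}" by (elim insertE emptyE) (simp_all add: insert_commute)
  qed (use that in auto)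
  show thesis
  proof (rule that[OF d(1) ne])
    show "medians L T = {{{a, b}, {a, d}}, {{a, d}, {d, b}}, {{d, b}, {a, b}}}"
      unfolding medians_def d(1) by (rule pairs[OF ne])
  qed
qed

lemma median_triangle:
  assumes T: "T \<in> bounded_faces L"
  defines "J \<equiv> (\<Union>m\<in>medians L T. img H m)"
  shows "card (medians L T) = 3" "jordan_curve J" "J \<subseteq> T \<union> frontier T"
    "frontier F = J \<Longrightarrow> F = inside J \<Longrightarrow> polygon_face H F 3" "inside J \<subseteq> T"
proof -
  obtain e f g where efg: "boundary_edges L T = {e, f, g}" "e \<noteq> f" "f \<noteq> g" "e \<noteq> g"
    "medians L T = {{e, f}, {f, g}, {g, e}}" using median_cycle[OF T] .
  have "{e, f} \<noteq> {f, g}" "{e, f} \<noteq> {g, e}" "{f, g} \<noteq> {g, e}" using efg by (auto simp: doubleton_eq_iff)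
  then show "card (medians L T) = 3" unfolding efg(5) by simp
  define vs where "vs = [e, f, g]"
  have lt3: "{..<3} = {0, Suc 0, Suc (Suc 0)}" by auto
  have vs: "distinct vs" "length vs = 3" using efg by (auto simp: vs_def)
  have E: "{vs ! i, vs ! (Suc i mod 3)} \<in> edges H" if "i < 3" for i
  proof -
    have "i = 0 \<or> i = Suc 0 \<or> i = Suc (Suc 0)" using that by auto
    then have "{vs ! i, vs ! (Suc i mod 3)} \<in> medians L T"
      unfolding efg(5) by (elim disjE) (simp_all add: vs_def)
    then show ?thesis using T edges_H by blast
  qed
  have Jeq: "J = (\<Union>i<3. img H {vs ! i, vs ! (Suc i mod 3)})"
    unfolding J_def efg(5) lt3 by (simp add: vs_def)
  show JJ: "jordan_curve J" unfolding Jeq by (rule plane_graph_cycle_jordan[OF plane_H vs _ E]) auto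
  show "polygon_face H F 3" if "frontier F = J" "F = inside J"
    unfolding polygon_face_def using vs E that Jeq by (intro exI[of _ vs]) auto
  have TF: "T \<in> faces" "bounded T" using T by (auto simp: bounded_faces_L)
  show JT: "J \<subseteq> T \<union> frontier T"
  proof
    fix x assume "x \<in> J"
    then obtain m where m: "m \<in> medians L T" "x \<in> img H m" by (auto simp: J_def)
    then obtain h k where hk: "m = {h, k}" "h \<in> boundary_edges L T" "k \<in> boundary_edges L T" "h \<noteq> k"
      by (auto simp: medians_def)
    have "mid L h \<in> frontier T" "mid L k \<in> frontier T"
      using hk mid_not_vertex(2)[OF plane] by (auto simp: boundary_edges_def)
    then show "x \<in> T \<union> frontier T" using median(4)[OF T hk(2-4)] m hk(1) by blast
  qed
  obtain a b c where abc: "{a, b} \<in> edges L" "{b, c} \<in> edges L" "{a, c} \<in> edges L" "frontier T = triangle L a b c"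
     "T \<in> components (- triangle L a b c)"
    using triangulation_face[OF tri large plane TF(1)] by metis
  define C where "C = triangle L a b c"
  have JC: "jordan_curve C" unfolding C_def using triangle_jordan[OF plane abc(1-3)] .
  note CC = jordan_curve_components[OF JC]
  note JJJ = jordan_curve_components[OF JJ]
  have TI: "T = inside C" using abc(5) CC(1,6) TF(2) unfolding C_def[symmetric] by auto
  have O: "outside C \<in> components (- C)" using CC by simp
  note OO = jordan_component_facts[OF JC O]
  have OT: "outside C \<inter> T = {}" using TI inside_Int_outside by blast
  \<comment> \<open>The exterior of \<open>C\<close> is connected, unbounded and off
    \<open>J\<close>, so it lies in a component of \<open>- J\<close> other than
    \<open>inside J\<close>. Being open, \<open>inside J\<close> then avoids the closure of that
    exterior as well, in particular \<open>C\<close>.\<close>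
  then have "outside C \<inter> J = {}" using JT abc(4) OO(5) unfolding C_def by blast
  then obtain G where G: "G \<in> components (- J)" "outside C \<subseteq> G"
    using exists_component_superset[of "outside C" "- J"] OO by blast
  have "G \<noteq> inside J" using G(2) CC(6) JJJ(5) bounded_subset by blast
  then have "inside J \<inter> outside C = {}"
    using G components_nonoverlap[of "inside J" "- J" G] JJJ(1) by blast
  moreover have "open (inside J)" using jordan_component_facts(2)[OF JJ] JJJ(1) by blast
  ultimately have "inside J \<inter> closure (outside C) = {}"
    by (simp add: open_Int_closure_eq_empty)
  then have "inside J \<inter> C = {}" using OO(6) by blast
  then show "inside J \<subseteq> T"
    using \<open>inside J \<inter> outside C = {}\<close> TI inside_Un_outside[of C] by blast
qed

text \<open>A half edge meets \<open>H\<close> only in its midpoint, so a face of \<open>H\<close>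
  that touches it elsewhere contains its vertex. A face without vertices therefore lies in a single
  face of \<open>L\<close>, where only the medians of that face can bound it.\<close>

lemma face_without_vertex:
  assumes F: "F \<in> bounded_faces H" and nv: "\<And>v. v \<in> vertices L \<Longrightarrow> point L v \<notin> F"
  obtains T where "T \<in> bounded_faces L" "frontier F = (\<Union>m\<in>medians L T. img H m)"
proof -
  have FH: "F \<in> components (- drawn H)" "bounded F" using F by (auto simp: bounded_faces_H)
  note FF = face_facts_H[OF FH(1)]
  have "F \<inter> drawn L = {}"
  proof (rule ccontr)
    assume "F \<inter> drawn L \<noteq> {}"
    then obtain x e where x: "x \<in> F" "e \<in> edges L" "x \<in> img L e" using nv by (auto simp: drawn_def)
    obtain u w where uw: "e = {u, w}" "u \<in> vertices L" "w \<in> vertices L" using plane_graph_edgeE[OF plane x(2)] .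
    have no: "x \<notin> half L {u, w} u" if e: "{u, w} \<in> edges L" "u \<in> vertices L" for u w
    proof
      assume xh: "x \<in> half L {u, w} u"
      note h = half_arcs(1)[OF plane e(1)] and d = half_disjoint_drawn_H[OF e(1)]
      have "x \<noteq> mid L {u, w}" using x(1) FF(4) mid_in_drawn_H[OF e(1)] by blast
      moreover have "connected (half L {u, w} u - {mid L {u, w}})"
        using is_arc_delete_end[OF is_arc_sym[OF h]] .
      ultimately have "half L {u, w} u - {mid L {u, w}} \<subseteq> F"
        using components_maximal[OF FH(1)] d xh x(1) by blast
      then show False using is_arc_ends[OF h] nv[OF e(2)] by blast
    qed
    show False
      using no[of u w] no[of w u] half_arcs(2)[OF plane, of u w] x uw by (auto simp: insert_commute)
  qed
  then obtain T where T: "T \<in> faces" "F \<subseteq> T"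
    using exists_component_superset[of F "- drawn L"] FF by blast
  have bT: "T \<in> bounded_faces L"
  proof (rule ccontr)
    assume nb: "T \<notin> bounded_faces L"
    \<comment> \<open>An unbounded \<open>T\<close> carries nothing of \<open>H\<close>, so it would
      be contained in the bounded face \<open>F\<close>.\<close>
    have "T \<inter> drawn H = {}" using drawn_H_in_face[OF T(1)] nb by blast
    then have "T \<subseteq> F" using components_maximal[OF FH(1) face_facts(2)[OF T(1)]] T(2) FF(3) by blast
    then have "bounded T" using FH(2) bounded_subset by blast
    then show False using nb T(1) by (simp add: bounded_faces_L)
  qed
  define J where "J = (\<Union>m\<in>medians L T. img H m)"
  have frJ: "frontier F \<subseteq> J"
  proof
    fix x assume x: "x \<in> frontier F"
    then have xH: "x \<in> drawn H" using FF(5) by blast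
    have "x \<in> closure T" using x T(2) closure_mono by (auto simp: frontier_def)
    then consider "x \<in> T" | "x \<in> frontier T" "x \<in> drawn L"
      using face_facts(5,6)[OF T(1)] closure_Un_frontier by blast
    then show "x \<in> J"
    proof cases
      case 1
      then obtain e f where "e \<in> boundary_edges L T" "f \<in> boundary_edges L T" "e \<noteq> f" "x \<in> img H {e, f}"
        using drawn_H_in_face[OF T(1) xH] by metis
      then show ?thesis using median(1)[OF bT] unfolding J_def by blast
    next
      case 2
      obtain e where e: "e \<in> edges L" "x = mid L e" using drawn_H_Int_drawn_L[OF xH 2(2)] .
      obtain a b c where abc: "{a, b} \<in> edges L" "{b, c} \<in> edges L" "{a, c} \<in> edges L" "frontier T = triangle L a b c"
        using triangulation_face[OF tri large plane T(1)] by metis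
      \<comment> \<open>On the frontier of \<open>T\<close> the drawings of \<open>L\<close> and
        \<open>H\<close> share only midpoints of sides of \<open>T\<close>, and these are ends of
        medians of \<open>T\<close>.\<close>
      have eT: "e \<in> boundary_edges L T"
        using 2(1) e mid_on_edge[OF plane e(1)] abc unfolding boundary_edges_def triangle_def by blast
      then obtain f where f: "f \<in> boundary_edges L T" "f \<noteq> e" using median_cycle[OF bT] by (metis insertCI)
      have "x \<in> img H {e, f}" using is_arc_ends[OF median(3)[OF bT eT f(1)]] f(2) e(2) by auto
      then show ?thesis using median(1)[OF bT eT f(1)] f(2) unfolding J_def by blast
    qed
  qed
  have "J \<subseteq> drawn H" using bT edges_H unfolding J_def drawn_def by blast
  then have "F \<in> components (- J)" using component_if_frontier_subset[OF FF(2,3) _ frJ] FF(4) by blast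
  then have "frontier F = J" using jordan_component_facts(1) median_triangle(2)[OF bT] unfolding J_def by blast
  then show thesis using that[OF bT] by (simp add: J_def)
qed

lemma face_bounded_by_medians:
  assumes F: "F \<in> bounded_faces H" and T: "T \<in> bounded_faces L" and b: "bounded_by_medians L H T F"
  shows "F \<subseteq> T" "card (medians L T) = 3" "polygon_face H F 3"
proof -
  have FH: "F \<in> components (- drawn H)" "bounded F" using F by (auto simp: bounded_faces_H)
  note FF = face_facts_H[OF FH(1)]
  define J where "J = (\<Union>m\<in>medians L T. img H m)"
  note MT = median_triangle[OF T, folded J_def]
  have fr: "frontier F = J" using b by (simp add: bounded_by_medians_def J_def)
  then have "F \<inter> J = {}" using FF(4,5) by blast
  then have "F \<in> components (- J)" using component_if_frontier_subset[OF FF(2,3)] fr by blast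
  then have "F = inside J" using jordan_curve_components[OF MT(2)] FH(2) by auto
  then show "F \<subseteq> T" "card (medians L T) = 3" "polygon_face H F 3" using MT(1,4,5) fr by auto
qed

section \<open>Faces of the conjugated triangulation around a vertex\<close>

definition share_corner :: "'a \<Rightarrow> 'a set \<Rightarrow> 'a set \<Rightarrow> bool" where
  "share_corner v e f \<longleftrightarrow> (\<exists>T\<in>bounded_faces L. e \<in> boundary_edges L T \<and> f \<in> boundary_edges L T \<and>
      e \<noteq> f \<and> v \<in> e \<and> v \<in> f)"

text \<open>\<open>F\<close> is open and contains a frontier point of \<open>T\<close>, so it meets
  \<open>T\<close>. An unbounded \<open>T\<close> has nothing of \<open>H\<close> in it and would
  lie in the bounded set \<open>F\<close>.\<close>

lemma bounded_face_around_vertex: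
  assumes F: "F \<in> bounded_faces H" and v: "v \<in> vertices L" "point L v \<in> F"
    and T: "T \<in> faces" "point L v \<in> frontier T"
  shows "T \<in> bounded_faces L"
proof (rule ccontr)
  assume nb: "T \<notin> bounded_faces L"
  have FH: "F \<in> components (- drawn H)" "bounded F" using F by (auto simp: bounded_faces_H)
  note FF = face_facts_H[OF FH(1)]
  have "point L v \<in> closure T" using T by (simp add: frontier_def)
  then have "F \<inter> T \<noteq> {}" using v(2) FF(1) by (metis IntI empty_iff open_Int_closure_eq_empty)
  moreover have "T \<inter> drawn H = {}" using drawn_H_in_face[OF T(1)] nb by blast
  ultimately have "T \<subseteq> F" using components_maximal[OF FH(1) face_facts(2)[OF T(1)]] by blast
  then show False using nb T(1) FH(2) bounded_subset by (auto simp: bounded_faces_L)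
qed

lemma edge_around_vertex:
  assumes F: "F \<in> bounded_faces H" and v: "v \<in> vertices L" "point L v \<in> F"
    and e: "e \<in> edges L" "v \<in> e"
  shows "\<exists>f g. f \<noteq> g \<and> f \<noteq> e \<and> g \<noteq> e \<and> share_corner v e f \<and> share_corner v e g"
proof -
  obtain a where a: "e = {v, a}" using plane_graph_edgeE[OF plane e(1)] e(2) by (metis insert_commute insertE singletonD)
  have other: "\<exists>f. f \<in> boundary_edges L T \<and> f \<noteq> e \<and> v \<in> f \<and> T \<in> bounded_faces L"
    if T: "T \<in> faces" "e \<in> boundary_edges L T" for T
  proof -
    obtain c where c: "{v, a} \<in> edges L" "{v, c} \<in> edges L" "{c, a} \<in> edges L" "frontier T = triangle L v c a"
      "boundary_edges L T = {{v, a}, {v, c}, {c, a}}"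
      using face_with_edge[OF T(1)] T(2) a by metis
    have "c \<noteq> a" using plane_graph_edge_ends[OF plane c(3)] by blast
    then have "{v, c} \<noteq> e" using a by (auto simp: doubleton_eq_iff)
    moreover have "point L v \<in> frontier T"
      using c plane_graph_on_edge[OF plane c(1) v(1)] by (auto simp: triangle_def)
    ultimately show ?thesis using bounded_face_around_vertex[OF F v T(1)] c(5) by blast
  qed
  obtain S T where ST: "S \<in> faces" "T \<in> faces" "S \<noteq> T" "e \<in> boundary_edges L S" "e \<in> boundary_edges L T"
    using edge_two_faces[OF e(1)] by metis
  obtain f where f: "f \<in> boundary_edges L S" "f \<noteq> e" "v \<in> f" "S \<in> bounded_faces L" using other[OF ST(1,4)] by blast
  obtain g where g: "g \<in> boundary_edges L T" "g \<noteq> e" "v \<in> g" "T \<in> bounded_faces L" using other[OF ST(2,5)] by blast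
  have "f \<noteq> g"
  proof
    assume "f = g"
    \<comment> \<open>\<open>H\<close> has a single curve for the pair of \<open>e\<close> and
      \<open>f\<close>, and its interior cannot lie in two disjoint faces.\<close>
    have "img H {e, f} - {mid L e, mid L f} \<subseteq> S \<inter> T"
      using median(4)[OF f(4) ST(4) f(1)] median(4)[OF g(4) ST(5) g(1)] f(2) \<open>f = g\<close> by auto
    then show False
      using is_arc_open_connected(2)[OF median(3)[OF f(4) ST(4) f(1)]] f(2) faces_disjoint[OF ST(1-3)] by auto
  qed
  then show ?thesis using f g ST e(2) unfolding share_corner_def by blast
qed

lemma closure_UN_finite: "finite I \<Longrightarrow> closure (\<Union>i\<in>I. A i) = (\<Union>i\<in>I. closure (A i))"
  for A :: "'i \<Rightarrow> complex set"
  by (induction I rule: finite_induct) auto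

lemma face_around_vertex:
  assumes F: "F \<in> bounded_faces H" and v: "v \<in> vertices L" "point L v \<in> F"
  shows "\<exists>k\<ge>3. polygon_face H F k"
proof -
  have FH: "F \<in> components (- drawn H)" "bounded F" using F by (auto simp: bounded_faces_H)
  note FF = face_facts_H[OF FH(1)]
  define X where "X = {e \<in> edges L. v \<in> e}"
  have "finite X" using plane_graph_finite(2)[OF plane] by (simp add: X_def)
  moreover have "X \<noteq> {}" using vertex_on_edge[OF v(1)] by (auto simp: X_def)
  moreover have "share_corner v e f \<Longrightarrow> share_corner v f e" for e f by (auto simp: share_corner_def)
  moreover have "\<exists>f\<in>X. \<exists>g\<in>X. f \<noteq> g \<and> f \<noteq> e \<and> g \<noteq> e \<and> share_corner v e f \<and> share_corner v e g" if e: "e \<in> X" for e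
  proof -
    have "f \<in> X" if "share_corner v e f" for f
      using that unfolding share_corner_def X_def boundary_edges_def by blast
    moreover have "e \<in> edges L" "v \<in> e" using e by (simp_all add: X_def)
    ultimately show ?thesis using edge_around_vertex[OF F v, of e] by blast
  qed
  \<comment> \<open>\<open>share_corner v\<close> makes the edges at \<open>v\<close> into the link
    graph of \<open>v\<close>, whose adjacencies are the medians that cut off corners at
    \<open>v\<close>. A cycle in it is thus a cycle of \<open>H\<close>.\<close>
  ultimately obtain vs where vs: "distinct vs" "length vs \<ge> 3" "set vs \<subseteq> X"
    "\<And>i. i < length vs \<Longrightarrow> share_corner v (vs ! i) (vs ! (Suc i mod length vs))"
    using cycle_if_two_neighbours[of X "share_corner v"] by metis
  define k where "k = length vs"
  define nx where "nx i = Suc i mod k" for i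
  have k: "k \<ge> 3" using vs by (simp add: k_def)
  have nx: "nx i < k" for i using k by (simp add: nx_def)
  have vsX: "vs ! i \<in> edges L" "v \<in> vs ! i" if "i < k" for i
  proof -
    have "vs ! i \<in> X" using vs(3) that nth_mem[of i vs] by (auto simp: k_def)
    then show "vs ! i \<in> edges L" "v \<in> vs ! i" by (simp_all add: X_def)
  qed
  have inj: "vs ! i = vs ! j \<longleftrightarrow> i = j" if "i < k" "j < k" for i j
    using that vs(1) nth_eq_iff_index_eq by (auto simp: k_def)
  have "\<exists>T. T \<in> bounded_faces L \<and> vs ! i \<in> boundary_edges L T \<and> vs ! nx i \<in> boundary_edges L T \<and> vs ! i \<noteq> vs ! nx i"
    if "i < k" for i
    using vs(4)[of i] that unfolding share_corner_def nx_def k_def by blast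
  then obtain T where T: "\<And>i. i < k \<Longrightarrow> T i \<in> bounded_faces L" "\<And>i. i < k \<Longrightarrow> vs ! i \<in> boundary_edges L (T i)"
    "\<And>i. i < k \<Longrightarrow> vs ! nx i \<in> boundary_edges L (T i)" "\<And>i. i < k \<Longrightarrow> vs ! i \<noteq> vs ! nx i" by metis
  have TF: "T i \<in> faces" if "i < k" for i using T(1)[OF that] by (simp add: bounded_faces_L)
  have far: "\<exists>a. vs ! i = {v, a}" if "i < k" for i
    using plane_graph_edgeE[OF plane vsX(1)[OF that]] vsX(2)[OF that] by (metis insert_commute insertE singletonD)
  define h where "h i = half L (vs ! i) v" for i
  define m where "m i = mid L (vs ! i)" for i
  define M where "M i = img H {vs ! i, vs ! nx i}" for i
  have "\<exists>Q. open Q \<and> connected Q \<and> Q \<subseteq> T i \<and> Q \<inter> drawn H = {} \<and> closure Q = Q \<union> (h i \<union> h (nx i) \<union> M i) \<and>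
      (\<forall>x \<in> h i \<union> h (nx i) - {m i, m (nx i)}. \<exists>r>0. ball x r \<inter> T i \<subseteq> Q)" if i: "i < k" for i
  proof -
    obtain a b where ab: "vs ! i = {v, a}" "vs ! nx i = {v, b}" using far[OF i] far[OF nx] by blast
    then have "a \<noteq> b" using T(4)[OF i] by auto
    have "{v, a} \<in> boundary_edges L (T i)" "{v, b} \<in> boundary_edges L (T i)" using T(2,3)[OF i] ab by auto
    from corner[OF T(1)[OF i] this \<open>a \<noteq> b\<close>] show ?thesis
      unfolding h_def m_def M_def ab by metis
  qed
  then have "\<forall>i\<in>{..<k}. \<exists>Q. open Q \<and> connected Q \<and> Q \<subseteq> T i \<and> Q \<inter> drawn H = {} \<and> closure Q = Q \<union> (h i \<union> h (nx i) \<union> M i) \<and>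
      (\<forall>x \<in> h i \<union> h (nx i) - {m i, m (nx i)}. \<exists>r>0. ball x r \<inter> T i \<subseteq> Q)" by blast
  then obtain Q where "\<forall>i\<in>{..<k}. open (Q i) \<and> connected (Q i) \<and> Q i \<subseteq> T i \<and> Q i \<inter> drawn H = {} \<and> closure (Q i) = Q i \<union> (h i \<union> h (nx i) \<union> M i) \<and>
      (\<forall>x \<in> h i \<union> h (nx i) - {m i, m (nx i)}. \<exists>r>0. ball x r \<inter> T i \<subseteq> Q i)"
    unfolding bchoice_iff by blast
  then have Q: "\<And>i. i < k \<Longrightarrow> open (Q i)" "\<And>i. i < k \<Longrightarrow> connected (Q i)"
    "\<And>i. i < k \<Longrightarrow> Q i \<subseteq> T i" "\<And>i. i < k \<Longrightarrow> Q i \<inter> drawn H = {}"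
    "\<And>i. i < k \<Longrightarrow> closure (Q i) = Q i \<union> (h i \<union> h (nx i) \<union> M i)"
    "\<And>i x. i < k \<Longrightarrow> x \<in> h i \<union> h (nx i) - {m i, m (nx i)} \<Longrightarrow> \<exists>r>0. ball x r \<inter> T i \<subseteq> Q i" by auto
  have h: "is_arc (h i) (point L v) (m i)" "h i \<inter> drawn H = {m i}" "h i \<subseteq> img L (vs ! i)"
    "h i \<inter> point L ` vertices L \<subseteq> {point L v}"
    "\<exists>R. closed R \<and> img L (vs ! i) = h i \<union> R \<and> h i \<inter> R = {m i}" if i: "i < k" for i
  proof -
    obtain a where a: "vs ! i = {v, a}" using far[OF i] by blast
    then have e: "{v, a} \<in> edges L" using vsX[OF i] by simp
    then have e': "{a, v} \<in> edges L" by (simp add: insert_commute)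
    note va = half_arcs[OF plane e] and av = half_arcs(1)[OF plane e', unfolded insert_commute[of a v]]
    show "is_arc (h i) (point L v) (m i)" "h i \<inter> drawn H = {m i}" "h i \<subseteq> img L (vs ! i)"
      using va half_disjoint_drawn_H[OF e] unfolding h_def m_def a by blast+
    show "\<exists>R. closed R \<and> img L (vs ! i) = h i \<union> R \<and> h i \<inter> R = {m i}"
      using va is_arc_closed[OF av] unfolding h_def m_def a by metis
    have "point L a \<notin> h i"
      using va(3) is_arc_ends[OF av] unfolding h_def a by blast
    then show "h i \<inter> point L ` vertices L \<subseteq> {point L v}"
      using plane_graph_on_edge[OF plane e] va(2) unfolding h_def a by blast
  qed
  \<comment> \<open>The point of \<open>v\<close> itself is left out: openness there would require
    knowing that the corners go all the way around \<open>v\<close>, whereas removing one point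
    leaves the open connected set \<open>F\<close> connected.\<close>
  define A where "A = (\<Union>i<k. Q i) \<union> (\<Union>i<k. h i - {point L v, m i})"
  define J where "J = (\<Union>i<k. M i)"
  \<comment> \<open>The half edges start at \<open>v\<close>, hence in \<open>F\<close>, and meet
    \<open>H\<close> only at their midpoints. Each corner has \<open>v\<close> in its closure and
    therefore meets the open set \<open>F\<close>.\<close>
  have hF: "h i - {m i} \<subseteq> F" if i: "i < k" for i
  proof (rule components_maximal[OF FH(1)])
    show "connected (h i - {m i})" using is_arc_delete_end[OF is_arc_sym[OF h(1)[OF i]]] .
    show "h i - {m i} \<subseteq> - drawn H" using h(2)[OF i] by blast
    show "F \<inter> (h i - {m i}) \<noteq> {}" using is_arc_ends[OF h(1)[OF i]] v(2) by blast
  qed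
  have QF: "Q i \<subseteq> F" if i: "i < k" for i
  proof (rule components_maximal[OF FH(1) Q(2)[OF i]])
    show "Q i \<subseteq> - drawn H" using Q(4)[OF i] by blast
    have "point L v \<in> closure (Q i)" using Q(5)[OF i] is_arc_ends[OF h(1)[OF i]] by blast
    then show "F \<inter> Q i \<noteq> {}" using v(2) FF(1) by (metis IntI empty_iff open_Int_closure_eq_empty)
  qed
  have "point L v \<notin> Q i" if i: "i < k" for i
    using Q(3)[OF i] face_disjoint_drawn[OF TF[OF i]] v(1) by (auto simp: drawn_def)
  then have AF: "A \<subseteq> F - {point L v}" using QF hF unfolding A_def by blast
  have openh: "\<exists>r>0. ball x r \<subseteq> A" if i: "i < k" and x: "x \<in> h i - {point L v, m i}" for i x
  proof -
    \<comment> \<open>The cyclic predecessor of \<open>i\<close>; adding \<open>k - 1\<close> avoids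
      the truncated subtraction at 0. The corners numbered \<open>j\<close> and \<open>i\<close> are
      the two that adjoin the half edge \<open>h i\<close>.\<close>
    define j where "j = (i + (k - 1)) mod k"
    have j: "j < k" using k by (simp add: j_def)
    have "nx j = (i + k) mod k" using k by (simp add: nx_def j_def mod_Suc_eq)
    then have nxj: "nx j = i" using i by simp
    have "nx (nx i) \<noteq> i" using i k by (auto simp: nx_def mod_Suc split: if_splits)
    then have "j \<noteq> nx i" using nxj by blast
    have ij: "i \<noteq> j" using T(4)[OF j] nxj by auto
    \<comment> \<open>Only two sides of a triangle contain \<open>v\<close>. If the faces agreed,
      the neighbours of \<open>vs ! i\<close> before and after it in the cycle would coincide, which
      a cycle of length at least 3 excludes.\<close>
    have TT: "T j \<noteq> T i"
    proof
      assume eq: "T j = T i"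
      obtain a where a: "vs ! i = {v, a}" using far[OF i] by blast
      obtain c where c: "{c, a} \<in> edges L" "boundary_edges L (T i) = {{v, a}, {v, c}, {c, a}}"
         "{v, a} \<in> edges L" "{v, c} \<in> edges L"
        using face_with_edge[OF TF[OF i], of v a] T(2)[OF i] a by metis
      have "v \<notin> {c, a}" using plane_graph_edge_ends[OF plane] c by auto
      then have "vs ! j = {v, c}" "vs ! nx i = {v, c}"
        using T(2)[OF j] T(3)[OF i] c(2) a eq vsX(2)[OF j] vsX(2)[OF nx, of i] inj[OF i j] ij T(4)[OF i] by auto
      then have "vs ! j = vs ! nx i" by simp
      then show False using inj[OF j nx] \<open>j \<noteq> nx i\<close> by blast
    qed
    have xe: "x \<in> img L (vs ! i)" "x \<notin> point L ` vertices L" using x h(3,4)[OF i] by blast+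
    have "vs ! i \<in> boundary_edges L (T j)" using T(3)[OF j] nxj by simp
    then obtain r0 where r0: "r0 > 0" "ball x r0 \<subseteq> T i \<union> T j \<union> img L (vs ! i)"
      using edge_two_sided[OF vsX(1)[OF i] TF[OF i] TF[OF j] TT[symmetric] T(2)[OF i] _ xe] by blast
    have neq: "x \<noteq> m l" if l: "l < k" for l
    proof
      assume "x = m l"
      then have "vs ! l = vs ! i" using mid_on_edge[OF plane vsX(1)[OF l] vsX(1)[OF i]] xe(1) by (simp add: m_def)
      then show False using inj[OF l i] x \<open>x = m l\<close> by blast
    qed
    obtain r1 where r1: "r1 > 0" "ball x r1 \<inter> T i \<subseteq> Q i"
      using Q(6)[OF i, of x] x neq[OF i] neq[OF nx] by blast
    obtain r2 where r2: "r2 > 0" "ball x r2 \<inter> T j \<subseteq> Q j"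
      using Q(6)[OF j, of x] x neq[OF i] neq[OF j] unfolding nxj by blast
    obtain R where R: "closed R" "img L (vs ! i) = h i \<union> R" "h i \<inter> R = {m i}" using h(5)[OF i] by blast
    have "closed (insert (point L v) R)" "x \<notin> insert (point L v) R" using R x by auto
    \<comment> \<open>This radius keeps the ball off \<open>v\<close> and off the far half of the
      edge, so that points of the edge in it belong to the open half edge.\<close>
    then obtain r3 where r3: "r3 > 0" "ball x r3 \<inter> insert (point L v) R = {}" using ball_avoiding_closed by blast
    define r where "r = min (min r0 r1) (min r2 r3)"
    have "r > 0" using r0 r1 r2 r3 by (simp add: r_def)
    moreover have "ball x r \<subseteq> A"
    proof
      fix p assume "p \<in> ball x r"
      then have p: "p \<in> ball x r0" "p \<in> ball x r1" "p \<in> ball x r2" "p \<in> ball x r3" by (auto simp: r_def)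
      consider "p \<in> T i" | "p \<in> T j" | "p \<in> img L (vs ! i)" using r0(2) p(1) by blast
      then show "p \<in> A"
      proof cases
        case 1 then show ?thesis using r1(2) p(2) i unfolding A_def by blast
      next
        case 2 then show ?thesis using r2(2) p(3) j unfolding A_def by blast
      next
        case 3
        then have "p \<in> h i - {point L v, m i}" using R r3(2) p(4) by blast
        then show ?thesis using i unfolding A_def by blast
      qed
    qed
    ultimately show ?thesis by blast
  qed
  have openQ: "\<exists>r>0. ball x r \<subseteq> A" if i: "i < k" and x: "x \<in> Q i" for i x
  proof -
    obtain r where "r > 0" "ball x r \<subseteq> Q i" using Q(1)[OF i] x open_contains_ball by blast
    then show ?thesis using i unfolding A_def by blast
  qed
  have "open A"
    unfolding open_contains_ball
  proof
    fix x assume "x \<in> A"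
    then consider i where "i < k" "x \<in> Q i" | i where "i < k" "x \<in> h i - {point L v, m i}"
      unfolding A_def by blast
    then show "\<exists>r>0. ball x r \<subseteq> A" by cases (use openQ openh in metis)+
  qed
  have clA: "closure A \<subseteq> A \<union> {point L v} \<union> J"
  proof -
    have hA: "h i \<subseteq> A \<union> {point L v} \<union> J" if i: "i < k" for i
    proof -
      have "m i \<in> M i"
        using is_arc_ends[OF median(3)[OF T(1)[OF i] T(2)[OF i] T(3)[OF i] T(4)[OF i]]] by (simp add: m_def M_def)
      then show ?thesis using i unfolding A_def J_def by blast
    qed
    have "closure (Q i) \<subseteq> A \<union> {point L v} \<union> J" if i: "i < k" for i
    proof -
      have "Q i \<subseteq> A" "M i \<subseteq> J" using i unfolding A_def J_def by blast+
      then show ?thesis using Q(5)[OF i] hA[OF i] hA[OF nx, of i] by blast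
    qed
    moreover have "closure (h i - {point L v, m i}) \<subseteq> A \<union> {point L v} \<union> J" if i: "i < k" for i
    proof -
      have "closure (h i - {point L v, m i}) \<subseteq> h i"
        using is_arc_closed[OF h(1)[OF i]] by (intro closure_minimal) auto
      then show ?thesis using hA[OF i] by blast
    qed
    ultimately show ?thesis unfolding A_def closure_Un by (simp add: closure_UN_finite UN_subset_iff)
  qed
  have E: "{vs ! i, vs ! nx i} \<in> edges H" if i: "i < k" for i
    using median(2)[OF T(1)[OF i] T(2)[OF i] T(3)[OF i] T(4)[OF i]] .
  have JH: "J \<subseteq> drawn H" using E unfolding J_def M_def drawn_def by blast
  have "A \<noteq> {}"
    using is_arc_open_connected(2)[OF h(1)[of 0]] k unfolding A_def by fastforce
  have FA: "F - {point L v} = A"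
  proof (rule ccontr)
    assume "F - {point L v} \<noteq> A"
    then have "(F - {point L v}) - A \<noteq> {}" "(F - {point L v}) \<inter> A \<noteq> {}" using AF \<open>A \<noteq> {}\<close> by blast+
    moreover have "connected (F - {point L v})" using connected_open_delete[OF FF(1,2)] by simp
    ultimately have "(F - {point L v}) \<inter> frontier A \<noteq> {}" using connected_Int_frontier by blast
    moreover have "frontier A \<subseteq> {point L v} \<union> J"
      using clA \<open>open A\<close> by (auto simp: frontier_def interior_open)
    ultimately show False using JH FF(4) by blast
  qed
  have "F = insert (point L v) A" using FA v(2) by blast
  then have "closure F = insert (point L v) (closure A)" by (metis closure_insert)
  then have "closure F \<subseteq> F \<union> J" using clA AF v(2) by auto
  then have frJ: "frontier F \<subseteq> J" using FF(1) by (auto simp: frontier_def interior_open)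
  have "F \<inter> J = {}" using JH FF(4) by blast
  then have FJ: "F \<in> components (- J)" using component_if_frontier_subset[OF FF(2,3) _ frJ] by blast
  have JJ: "jordan_curve J"
    unfolding J_def M_def nx_def
    by (rule plane_graph_cycle_jordan[OF plane_H vs(1)]) (use k E in \<open>auto simp: k_def nx_def\<close>)
  have "F = inside J" using FJ jordan_curve_components[OF JJ] FH(2) by auto
  moreover have "frontier F = J" using jordan_component_facts(1)[OF JJ FJ] .
  ultimately have "polygon_face H F k"
    unfolding polygon_face_def using vs(1) E by (intro exI[of _ vs]) (auto simp: k_def nx_def J_def M_def)
  then show ?thesis using k by blast
qed

end

section \<open>The two classes of bounded faces\<close>

theorem theorem8:
  fixes L :: "'a drawing" and H :: "'a set drawing"
  assumes "planar_triangulation (vertices L) (edges L)"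
    and "card (vertices L) \<ge> 3"
    and "plane_graph L"
    and "conjugated_triangulation L H"
  defines "class1 \<equiv> {F \<in> bounded_faces H. \<exists>T\<in>bounded_faces L. bounded_by_medians L H T F}"
    and "class2 \<equiv> {F \<in> bounded_faces H. \<exists>v\<in>vertices L. point L v \<in> interior F}"
  shows "bounded_faces H = class1 \<union> class2 \<and> class1 \<inter> class2 = {} \<and>
    (\<forall>F\<in>class1. \<forall>T\<in>bounded_faces L. bounded_by_medians L H T F \<longrightarrow>
        F \<subseteq> T \<and> card (medians L T) = 3 \<and> polygon_face H F 3) \<and>
    (\<forall>F\<in>class2. \<exists>k\<ge>3. polygon_face H F k)"
proof -
  interpret conjugated L H
    by unfold_locales (fact assms)+
  have int: "interior F = F" if "F \<in> bounded_faces H" for F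
    using that face_facts_H(1) by (auto simp: bounded_faces_H interior_open)
  have "F \<in> class1 \<union> class2" if F: "F \<in> bounded_faces H" for F
  proof (cases "\<exists>v\<in>vertices L. point L v \<in> F")
    case True
    then show ?thesis using F int[OF F] by (auto simp: class2_def)
  next
    case False
    then obtain T where "T \<in> bounded_faces L" "frontier F = (\<Union>m\<in>medians L T. img H m)"
      using face_without_vertex[OF F] by blast
    then show ?thesis using F by (auto simp: class1_def bounded_by_medians_def)
  qed
  \<comment> \<open>A face bounded by medians of \<open>T\<close> lies in \<open>T\<close>, and a
    face of \<open>L\<close> contains no vertex of \<open>L\<close>.\<close>
  moreover have "class1 \<inter> class2 = {}"
  proof (rule ccontr)
    assume "class1 \<inter> class2 \<noteq> {}"
    then obtain F T v where F: "F \<in> bounded_faces H" "T \<in> bounded_faces L" "bounded_by_medians L H T F"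
      "v \<in> vertices L" "point L v \<in> interior F" by (auto simp: class1_def class2_def)
    then have "point L v \<in> T" using face_bounded_by_medians(1) int by blast
    then show False
      using face_disjoint_drawn[of T] F(2,4) by (auto simp: bounded_faces_L drawn_def)
  qed
  moreover have "\<exists>k\<ge>3. polygon_face H F k" if "F \<in> class2" for F
    using that face_around_vertex int by (auto simp: class2_def)
  ultimately show ?thesis
    using face_bounded_by_medians by (auto simp: class1_def class2_def)
qed

end
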